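(* Let $d_{10}\neq0$ and $d_{12}$ be real constants, let $f_2(r)$ be a real function, and consider the Hamiltonian $$H=-\frac{\hbar^2}{2}\nabla^2+V_0+\frac12V_1(\vec\sigma_1+\vec\sigma_2,\vec L)+V_2(\vec\sigma_1,\vec\sigma_2)+V_3(\vec x,\vec\sigma_1)(\vec x,\vec\sigma_2)+V_4(\vec\sigma_1,\vec p)(\vec\sigma_2,\vec p)$$ with $$V_0=d_{12}+\frac{r^2f_2^2}{2d_{10}^2},\quad V_1=\frac{f_2}{d_{10}},\quad V_2=\frac{\hbar(2f_2+rf_2')}{2d_{10}},\quad V_3=-\frac{rf_2^2+d_{10}\hbar f_2'}{2d_{10}^2r},\quad V_4=-\frac12.$$ Let $K=(\vec\sigma_1,\vec\sigma_2)$ and let $$Y_P^{33}=\frac12\left[(\vec\sigma_1-\vec\sigma_2,\vec p)+\frac{f_2(r)}{d_{10}}(\vec x,\vec\sigma_1\times\vec\sigma_2)\right],\qquad Y_P^{34}=f_2(r)(\vec\sigma_2-\vec\sigma_1,\vec x)+d_{10}(\vec\sigma_1\times\vec\sigma_2,\vec p).$$ Then $K,Y_P^{33},Y_P^{34}$ (which are integrals of motion of $H$) generate a finite polynomial symmetry algebra. Their non-trivial commutation relations are $$[K,Y_P^{33}]=\frac{2i}{d_{10}}Y_P^{34},\qquad [K,Y_P^{34}]=-8id_{10}Y_P^{33},\qquad [Y_P^{33},Y_P^{34}]=2id_{10}(K+1)(H-d_{12}).$$ Moreover, $$(Y_P^{33})^2=H-d_{12},\qquad (Y_P^{34})^2=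4d_{10}^2(H-d_{12}).$$
   Context: $\vec x\in\mathbb R^3\setminus\{0\}$, $r=|\vec x|$, $p_k=-i\hbar\,\partial/\partial x_k$ with $\hbar>0$, $\vec L=\vec x\times\vec p$, $(\cdot,\cdot)$ is the Euclidean inner product; $\vec\sigma$ is the vector of Pauli matrices, $\vec\sigma_1=\vec\sigma\otimes I_2$, $\vec\sigma_2=I_2\otimes\vec\sigma$; a prime denotes $d/dr$. Operators act on smooth $\mathbb C^4$-valued functions on $\mathbb R^3\setminus\{0\}$ ($f_2$ smooth); products are in the order written. An integral of motion is an operator commuting with $H$; a finite polynomial symmetry algebra is one generated by finitely many integrals of motion whose pairwise commutators are polynomials in the generators and $H$. *)

theory Defs
  imports "HOL-Analysis.Analysis" "HOL-Library.Function_Algebras"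
begin

text \<open>
  Operators are maps on all functions \<open>real^3 \<Rightarrow> complex^(2 \<times> 2)\<close>; only smooth arguments and values
  away from the origin matter (see \<open>op_eq\<close>).  Sums and differences of operators, and of vectors of
  operators, are pointwise (Function_Algebras); the product of operators is composition.  The index
  type \<open>2 \<times> 2\<close> labels the product basis of the tensor product of two copies of C^2.
\<close>

type_synonym spinor_field = "real^3 \<Rightarrow> complex^(2 \<times> 2)"
type_synonym operator = "spinor_field \<Rightarrow> spinor_field"

text \<open>Composition, binding more tightly than \<open>+\<close> and \<open>-\<close> (which \<open>\<circ>\<close> does not).\<close>

abbreviation op_prod :: "operator \<Rightarrow> operator \<Rightarrow> operator"  (infixl "\<odot>" 70) where
  "A \<odot> B \<equiv> A \<circ> B"

definition partial_deriv ::
    "'a \<Rightarrow> ('a::real_normed_vector \<Rightarrow> 'b::real_normed_vector) \<Rightarrow> 'a \<Rightarrow> 'b" where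
  "partial_deriv b f x = frechet_derivative f (at x) b"

text \<open>Intended for open \<open>S\<close> only, since the derivatives are taken at full neighbourhoods.\<close>

primrec Ck_on ::
    "nat \<Rightarrow> 'a set \<Rightarrow> ('a::euclidean_space \<Rightarrow> 'b::real_normed_vector) \<Rightarrow> bool" where
  "Ck_on 0 S f \<longleftrightarrow> continuous_on S f"
| "Ck_on (Suc n) S f \<longleftrightarrow>
     (\<forall>x\<in>S. f differentiable (at x)) \<and> (\<forall>b\<in>Basis. Ck_on n S (partial_deriv b f))"

definition smooth_on ::
    "'a set \<Rightarrow> ('a::euclidean_space \<Rightarrow> 'b::real_normed_vector) \<Rightarrow> bool" where
  "smooth_on S f \<longleftrightarrow> (\<forall>n. Ck_on n S f)"

abbreviation smooth_field :: "spinor_field \<Rightarrow> bool" where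
  "smooth_field \<psi> \<equiv> smooth_on (- {0}) \<psi>"

definition op_eq :: "operator \<Rightarrow> operator \<Rightarrow> bool"  (infix "\<doteq>" 50) where
  "A \<doteq> B \<longleftrightarrow> (\<forall>\<psi>. smooth_field \<psi> \<longrightarrow> (\<forall>x. x \<noteq> 0 \<longrightarrow> A \<psi> x = B \<psi> x))"

definition mult_op :: "(real^3 \<Rightarrow> complex) \<Rightarrow> operator" where
  "mult_op g \<psi> x = g x *s \<psi> x"

abbreviation const_op :: "complex \<Rightarrow> operator" where
  "const_op c \<equiv> mult_op (\<lambda>_. c)"

abbreviation radial_op :: "(real \<Rightarrow> real) \<Rightarrow> operator" where
  "radial_op V \<equiv> mult_op (\<lambda>x. complex_of_real (V (norm x)))"

definition matrix_op :: "complex^(2 \<times> 2)^(2 \<times> 2) \<Rightarrow> operator" where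
  "matrix_op M \<psi> x = M *v \<psi> x"

definition partial_op :: "3 \<Rightarrow> operator" where
  "partial_op k = partial_deriv (axis k 1)"

definition laplacian :: operator where
  "laplacian = (\<Sum>k\<in>UNIV. partial_op k \<odot> partial_op k)"

definition dot_op :: "(3 \<Rightarrow> operator) \<Rightarrow> (3 \<Rightarrow> operator) \<Rightarrow> operator" where
  "dot_op A B = (\<Sum>k\<in>UNIV. A k \<odot> B k)"

text \<open>Indices are added modulo 3, so \<open>(k, k + 1, k + 2)\<close> is a cyclic permutation of \<open>(1, 2, 3)\<close>.\<close>

definition cross_op :: "(3 \<Rightarrow> operator) \<Rightarrow> (3 \<Rightarrow> operator) \<Rightarrow> 3 \<Rightarrow> operator" where
  "cross_op A B k = A (k + 1) \<odot> B (k + 2) - A (k + 2) \<odot> B (k + 1)"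

definition position :: "3 \<Rightarrow> operator" where
  "position k = mult_op (\<lambda>x. complex_of_real (x $ k))"

definition momentum :: "real \<Rightarrow> 3 \<Rightarrow> operator" where
  "momentum hbar k = const_op (- \<i> * complex_of_real hbar) \<odot> partial_op k"

definition angular_momentum :: "real \<Rightarrow> 3 \<Rightarrow> operator" where
  "angular_momentum hbar = cross_op position (momentum hbar)"

definition pauli :: "3 \<Rightarrow> complex^2^2" where
  "pauli k =
     (if k = 1 then vector [vector [0, 1], vector [1, 0]]
      else if k = 2 then vector [vector [0, - \<i>], vector [\<i>, 0]]
      else vector [vector [1, 0], vector [0, - 1]])"

definition kronecker ::
    "'a::times^'n^'m \<Rightarrow> 'a^'q^'p \<Rightarrow> 'a^('n::finite \<times> 'q::finite)^('m::finite \<times> 'p::finite)" where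
  "kronecker A B = (\<chi> i j. A $ fst i $ fst j * B $ snd i $ snd j)"

definition sigma1 :: "3 \<Rightarrow> operator" where
  "sigma1 k = matrix_op (kronecker (pauli k) (mat 1))"

definition sigma2 :: "3 \<Rightarrow> operator" where
  "sigma2 k = matrix_op (kronecker (mat 1) (pauli k))"

definition hamiltonian ::
    "real \<Rightarrow> (real \<Rightarrow> real) \<Rightarrow> (real \<Rightarrow> real) \<Rightarrow> (real \<Rightarrow> real) \<Rightarrow> (real \<Rightarrow> real) \<Rightarrow> (real \<Rightarrow> real)
      \<Rightarrow> operator" where
  "hamiltonian hbar V0 V1 V2 V3 V4 =
     const_op (complex_of_real (- (hbar\<^sup>2 / 2))) \<odot> laplacian
     + radial_op V0
     + const_op (1 / 2) \<odot> radial_op V1 \<odot> dot_op (sigma1 + sigma2) (angular_momentum hbar)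
     + radial_op V2 \<odot> dot_op sigma1 sigma2
     + radial_op V3 \<odot> dot_op position sigma1 \<odot> dot_op position sigma2
     + radial_op V4 \<odot> dot_op sigma1 (momentum hbar) \<odot> dot_op sigma2 (momentum hbar)"

definition spin_spin :: operator where
  "spin_spin = dot_op sigma1 sigma2"

definition Y_P33 :: "real \<Rightarrow> real \<Rightarrow> (real \<Rightarrow> real) \<Rightarrow> operator" where
  "Y_P33 hbar d10 f2 =
     const_op (1 / 2) \<odot>
       (dot_op (sigma1 - sigma2) (momentum hbar)
        + radial_op (\<lambda>r. f2 r / d10) \<odot> dot_op position (cross_op sigma1 sigma2))"

definition Y_P34 :: "real \<Rightarrow> real \<Rightarrow> (real \<Rightarrow> real) \<Rightarrow> operator" where
  "Y_P34 hbar d10 f2 =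
     radial_op f2 \<odot> dot_op (sigma2 - sigma1) position
     + const_op (complex_of_real d10) \<odot> dot_op (cross_op sigma1 sigma2) (momentum hbar)"

definition commutator :: "operator \<Rightarrow> operator \<Rightarrow> operator" where
  "commutator A B = A \<odot> B - B \<odot> A"

text \<open>
  \<open>A\<close> induces a complex-linear map of the space of smooth functions on the punctured space to
  itself; the first condition says that the value assigned to the origin is irrelevant.
\<close>

definition smooth_operator :: "operator \<Rightarrow> bool" where
  "smooth_operator A \<longleftrightarrow>
     (\<forall>\<phi> \<psi>. smooth_field \<phi> \<longrightarrow> smooth_field \<psi> \<longrightarrow> (\<forall>x. x \<noteq> 0 \<longrightarrow> \<phi> x = \<psi> x) \<longrightarrow>
        (\<forall>x. x \<noteq> 0 \<longrightarrow> A \<phi> x = A \<psi> x)) \<and>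
     (\<forall>\<psi>. smooth_field \<psi> \<longrightarrow> smooth_field (A \<psi>)) \<and>
     (\<forall>\<phi> \<psi> x. smooth_field \<phi> \<longrightarrow> smooth_field \<psi> \<longrightarrow> x \<noteq> 0 \<longrightarrow> A (\<phi> + \<psi>) x = A \<phi> x + A \<psi> x) \<and>
     (\<forall>c \<psi> x. smooth_field \<psi> \<longrightarrow> x \<noteq> 0 \<longrightarrow> A (\<lambda>y. c *s \<psi> y) x = c *s A \<psi> x)"

definition integral_of_motion :: "operator \<Rightarrow> operator \<Rightarrow> bool" where
  "integral_of_motion H A \<longleftrightarrow> smooth_operator A \<and> commutator H A \<doteq> 0"

text \<open>
  A polynomial in the operators \<open>X\<^sub>1, \<dots>, X\<^sub>n\<close> is a complex linear combination of the ordered monomials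
  \<open>X\<^sub>1^e\<^sub>1 \<dots> X\<^sub>n^e\<^sub>n\<close>.  With arbitrary words in the generators instead, every commutator \<open>AB - BA\<close>
  would be a polynomial for trivial reasons.
\<close>

fun op_monomial :: "operator list \<Rightarrow> nat list \<Rightarrow> operator" where
  "op_monomial (X # Xs) (e # es) = (X ^^ e) \<odot> op_monomial Xs es"
| "op_monomial _ _ = id"

inductive_set op_polynomials :: "operator list \<Rightarrow> operator set" for Xs where
  monomial: "length es = length Xs \<Longrightarrow> op_monomial Xs es \<in> op_polynomials Xs"
| scale: "P \<in> op_polynomials Xs \<Longrightarrow> const_op c \<odot> P \<in> op_polynomials Xs"
| add: "P \<in> op_polynomials Xs \<Longrightarrow> Q \<in> op_polynomials Xs \<Longrightarrow> P + Q \<in> op_polynomials Xs"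

definition generate_finite_polynomial_symmetry_algebra :: "operator \<Rightarrow> operator list \<Rightarrow> bool" where
  "generate_finite_polynomial_symmetry_algebra H Gs \<longleftrightarrow>
     smooth_operator H \<and>
     (\<forall>A\<in>set Gs. integral_of_motion H A) \<and>
     (\<forall>A\<in>set Gs. \<forall>B\<in>set Gs. \<exists>P\<in>op_polynomials (Gs @ [H]). commutator A B \<doteq> P)"

end

theory Submission imports Defs begin

text \<open>
  Put \<open>Q = K + 1\<close>, twice the operator exchanging the two spins.  Then \<open>Q\<^sup>2 = 4\<close>, and multiplication by \<open>Q\<close>
  interchanges, up to factors \<open>\<plusminus> 2 i\<close>, the two spin vectors \<open>\<sigma>\<^sub>1 - \<sigma>\<^sub>2\<close> and \<open>\<sigma>\<^sub>1 \<times> \<sigma>\<^sub>2\<close>, both of which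
  anticommute with it.  Hence \<open>Y\<^sub>3\<^sub>3\<close> anticommutes with \<open>Q\<close> and \<open>Y\<^sub>3\<^sub>4 = - i d\<^sub>1\<^sub>0 Q Y\<^sub>3\<^sub>3\<close>.  All commutation
  relations follow formally from these facts and the identity \<open>Y\<^sub>3\<^sub>3\<^sup>2 = H - d\<^sub>1\<^sub>2\<close>, which is the only
  analytic computation.  It sorts the square of a first-order operator by the order of the derivatives
  of the field; the second-order part needs the symmetry of second partial derivatives.
\<close>

section \<open>Smooth functions\<close>

lemma partial_deriv_eq:
  assumes "(f has_derivative f') (at x)"
  shows "partial_deriv b f x = f' b"
  using frechet_derivative_at[OF assms] by (simp add: partial_deriv_def)

lemma partial_deriv_cong_open:
  assumes "open S" "x \<in> S" "\<And>y. y \<in> S \<Longrightarrow> f y = g y"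
  shows "partial_deriv b f x = partial_deriv b g x"
proof -
  \<comment> \<open>\<open>frechet_derivative\<close> is a choice among all D with
    \<open>has_derivative\<close>. Local agreement gives both functions the same candidates, hence
    the same choice, even where no derivative exists.\<close>
  have "(f has_derivative D) (at x) = (g has_derivative D) (at x)" for D
    using assms by (metis has_derivative_transform_within_open)
  then show ?thesis by (simp add: partial_deriv_def frechet_derivative_def)
qed

lemma differentiable_cong_open:
  assumes "open S" "x \<in> S" "\<And>y. y \<in> S \<Longrightarrow> f y = g y" "f differentiable (at x)"
  shows "g differentiable (at x)"
  using assms unfolding differentiable_def by (metis has_derivative_transform_within_open)

text \<open>Derivative rules and operator identities are known only on S. Openness carries an
  equality on S over to the derivatives there, so it can be used at every order.\<close>

lemma Ck_on_cong:
  assumes "open S" "\<And>x. x \<in> S \<Longrightarrow> f x = g x" "Ck_on n S f"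
  shows "Ck_on n S g"
  using assms(2,3)
proof (induction n arbitrary: f g)
  case 0
  then show ?case by (simp cong: continuous_on_cong)
next
  case (Suc n)
  have "Ck_on n S (partial_deriv b g)" if "b \<in> Basis" for b
    using Suc.IH[of "partial_deriv b f"] Suc.prems that
      partial_deriv_cong_open[OF assms(1), of _ f g] by auto
  moreover have "g differentiable (at x)" if "x \<in> S" for x
    using Suc.prems differentiable_cong_open[OF assms(1) that, of f g] that by auto
  ultimately show ?case by simp
qed

text \<open>\<open>Ck_on (Suc n)\<close> does not mention continuity of f itself; differentiability
  supplies it at the bottom of the induction.\<close>

lemma Ck_on_SucD: "Ck_on (Suc n) S f \<Longrightarrow> Ck_on n S f"
proof (induction n arbitrary: f)
  case 0
  then have "\<forall>x\<in>S. f differentiable (at x within S)"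
    by (simp add: differentiable_at_withinI)
  then show ?case
    by (simp add: continuous_on_eq_continuous_within differentiable_imp_continuous_within)
next
  case (Suc n)
  show ?case
    unfolding Ck_on.simps(2)[of n]
    using Suc.prems Suc.IH unfolding Ck_on.simps(2)[of "Suc n"] by blast
qed

lemma partial_deriv_bounded_linear:
  assumes "bounded_linear L" "f differentiable (at x)"
  shows "partial_deriv b (\<lambda>y. L (f y)) x = L (partial_deriv b f x)"
    and "(\<lambda>y. L (f y)) differentiable (at x)"
proof -
  have "((\<lambda>y. L (f y)) has_derivative (\<lambda>h. L (frechet_derivative f (at x) h))) (at x)"
    using assms(2) unfolding frechet_derivative_works by (rule bounded_linear.has_derivative[OF assms(1)])
  then show "partial_deriv b (\<lambda>y. L (f y)) x = L (partial_deriv b f x)"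
    "(\<lambda>y. L (f y)) differentiable (at x)"
    by (simp add: partial_deriv_eq partial_deriv_def[of b f], unfold differentiable_def, blast)
qed

lemma partial_deriv_add:
  assumes "f differentiable (at x)" "g differentiable (at x)"
  shows "partial_deriv b (\<lambda>y. f y + g y) x = partial_deriv b f x + partial_deriv b g x"
proof -
  have "((\<lambda>y. f y + g y) has_derivative
      (\<lambda>h. frechet_derivative f (at x) h + frechet_derivative g (at x) h)) (at x)"
    using assms by (intro has_derivative_add) (simp_all add: frechet_derivative_works)
  then show ?thesis by (simp add: partial_deriv_eq partial_deriv_def[of b f] partial_deriv_def[of b g])
qed

lemma partial_deriv_bilinear:
  assumes "bounded_bilinear B" "f differentiable (at x)" "g differentiable (at x)"
  shows "partial_deriv b (\<lambda>y. B (f y) (g y)) x = B (f x) (partial_deriv b g x) + B (partial_deriv b f x) (g x)"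
    and "(\<lambda>y. B (f y) (g y)) differentiable (at x)"
proof -
  have "((\<lambda>y. B (f y) (g y)) has_derivative
      (\<lambda>h. B (f x) (frechet_derivative g (at x) h) + B (frechet_derivative f (at x) h) (g x))) (at x)"
    using assms by (intro bounded_bilinear.FDERIV) (simp_all add: frechet_derivative_works)
  then show "partial_deriv b (\<lambda>y. B (f y) (g y)) x
      = B (f x) (partial_deriv b g x) + B (partial_deriv b f x) (g x)"
    "(\<lambda>y. B (f y) (g y)) differentiable (at x)"
    by (simp add: partial_deriv_eq partial_deriv_def[of b f] partial_deriv_def[of b g],
        unfold differentiable_def, blast)
qed

section \<open>Closure properties of smooth functions\<close>

lemma Ck_on_const: "Ck_on n S (\<lambda>x. c)"
proof (induction n arbitrary: c)
  case (Suc n)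
  have "partial_deriv b (\<lambda>x. c) = (\<lambda>x. 0)" for b :: 'a
    by (rule ext, rule partial_deriv_eq) (rule has_derivative_const)
  with Suc show ?case by simp
qed simp

lemma Ck_on_bounded_linear:
  assumes "open S" "bounded_linear L" "Ck_on n S f"
  shows "Ck_on n S (\<lambda>x. L (f x))"
  using assms(3)
proof (induction n arbitrary: f)
  case 0
  then show ?case using assms(2) by (simp add: bounded_linear.continuous_on)
next
  case (Suc n)
  have "Ck_on n S (partial_deriv b (\<lambda>x. L (f x)))" if "b \<in> Basis" for b
    by (rule Ck_on_cong[OF assms(1) _ Suc.IH[of "partial_deriv b f"]])
      (use Suc.prems that in \<open>auto simp: partial_deriv_bounded_linear(1)[OF assms(2)]\<close>)
  with Suc.prems show ?case by (simp add: partial_deriv_bounded_linear(2)[OF assms(2)])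
qed

lemma Ck_on_add:
  assumes "open S" "Ck_on n S f" "Ck_on n S g"
  shows "Ck_on n S (\<lambda>x. f x + g x)"
  using assms(2,3)
proof (induction n arbitrary: f g)
  case 0
  then show ?case by (simp add: continuous_on_add)
next
  case (Suc n)
  have "Ck_on n S (partial_deriv b (\<lambda>x. f x + g x))" if "b \<in> Basis" for b
    by (rule Ck_on_cong[OF assms(1) _ Suc.IH[of "partial_deriv b f" "partial_deriv b g"]])
      (use Suc.prems that in \<open>auto simp: partial_deriv_add\<close>)
  with Suc.prems show ?case by simp
qed

text \<open>By the product rule a derivative is again a sum of two values of B, in which the
  undifferentiated factor is used at order n only; \<open>Ck_on_SucD\<close> lowers it to that
  order.\<close>

lemma Ck_on_bilinear:
  assumes "open S" "bounded_bilinear B" "Ck_on n S f" "Ck_on n S g"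
  shows "Ck_on n S (\<lambda>x. B (f x) (g x))"
  using assms(3,4)
proof (induction n arbitrary: f g)
  case 0
  then show ?case using assms(2) by (simp add: bounded_bilinear.continuous_on)
next
  case (Suc n)
  have "Ck_on n S (partial_deriv b (\<lambda>x. B (f x) (g x)))" if "b \<in> Basis" for b
    by (rule Ck_on_cong[OF assms(1) _
          Ck_on_add[OF assms(1) Suc.IH[of f "partial_deriv b g"] Suc.IH[of "partial_deriv b f" g]]])
      (use Suc.prems that in \<open>auto simp: partial_deriv_bilinear(1)[OF assms(2)] intro: Ck_on_SucD\<close>)
  with Suc.prems show ?case by (simp add: partial_deriv_bilinear(2)[OF assms(2)])
qed

lemma smooth_on_cong:
  "open S \<Longrightarrow> (\<And>x. x \<in> S \<Longrightarrow> f x = g x) \<Longrightarrow> smooth_on S f \<Longrightarrow> smooth_on S g"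
  unfolding smooth_on_def by (meson Ck_on_cong)

lemma smooth_on_const: "smooth_on S (\<lambda>x. c)"
  by (simp add: smooth_on_def Ck_on_const)

lemma smooth_on_differentiable: "smooth_on S f \<Longrightarrow> x \<in> S \<Longrightarrow> f differentiable (at x)"
  using Ck_on.simps(2)[of 0 S f] unfolding smooth_on_def by blast

lemma smooth_on_partial_deriv: "smooth_on S f \<Longrightarrow> b \<in> Basis \<Longrightarrow> smooth_on S (partial_deriv b f)"
  using Ck_on.simps(2)[of _ S f] unfolding smooth_on_def by blast

lemma smooth_on_continuous: "smooth_on S f \<Longrightarrow> continuous_on S f"
  unfolding smooth_on_def by (metis Ck_on.simps(1))

lemma smooth_on_compose_bounded_linear:
  "open S \<Longrightarrow> bounded_linear L \<Longrightarrow> smooth_on S f \<Longrightarrow> smooth_on S (\<lambda>x. L (f x))"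
  by (simp add: smooth_on_def Ck_on_bounded_linear)

lemma smooth_on_add:
  "open S \<Longrightarrow> smooth_on S f \<Longrightarrow> smooth_on S g \<Longrightarrow> smooth_on S (\<lambda>x. f x + g x)"
  by (simp add: smooth_on_def Ck_on_add)

lemma smooth_on_bilinear:
  "open S \<Longrightarrow> bounded_bilinear B \<Longrightarrow> smooth_on S f \<Longrightarrow> smooth_on S g \<Longrightarrow> smooth_on S (\<lambda>x. B (f x) (g x))"
  by (simp add: smooth_on_def Ck_on_bilinear)

lemmas smooth_on_mult = smooth_on_bilinear[OF _ bounded_bilinear_mult]

lemma smooth_on_bounded_linear:
  assumes "bounded_linear L"
  shows "smooth_on S L"
  unfolding smooth_on_def
proof
  fix n
  have "partial_deriv b L = (\<lambda>x. L b)" for b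
    using assms by (intro ext partial_deriv_eq bounded_linear_imp_has_derivative)
  moreover have "L differentiable (at x)" for x
    using assms bounded_linear_imp_differentiable by blast
  moreover have "continuous_on S L"
    using assms by (simp add: linear_continuous_on)
  ultimately show "Ck_on n S L"
    by (cases n) (auto simp: Ck_on_const)
qed

text \<open>The derivative is minus the square of the function itself, so order n and the product
  rule yield order n + 1.\<close>

lemma smooth_on_inverse_pos: "smooth_on {0<..} (\<lambda>r::real. inverse r)"
  unfolding smooth_on_def
proof
  fix n
  show "Ck_on n {0<..} (\<lambda>r::real. inverse r)"
  proof (induction n)
    case 0
    show ?case by (auto intro!: continuous_intros)
  next
    case (Suc n)
    have *: "((\<lambda>r. inverse r) has_derivative (\<lambda>h. - (inverse r * h * inverse r))) (at r)" if "r > 0" for r :: real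
      using that by (intro has_derivative_inverse') auto
    have d: "partial_deriv 1 (\<lambda>r. inverse r) r = - (inverse r * inverse r)"
      "(\<lambda>r. inverse r) differentiable (at r)" if "r > 0" for r :: real
      using partial_deriv_eq[OF *[OF that], of 1] differentiableI[OF *[OF that]] by simp_all
    have "Ck_on n {0<..} (\<lambda>r::real. - (inverse r * inverse r))"
      by (rule Ck_on_bounded_linear[OF _ bounded_linear_minus[OF bounded_linear_ident]
            Ck_on_bilinear[OF _ bounded_bilinear_mult Suc Suc]]) auto
    then have "Ck_on n {0<..} (partial_deriv 1 (\<lambda>r::real. inverse r))"
      by (rule Ck_on_cong[rotated 2]) (auto simp: d)
    then show ?case by (simp add: d)
  qed
qed

section \<open>One real variable and radial functions\<close>

lemma partial_deriv_eq_deriv: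
  fixes f :: "real \<Rightarrow> real"
  assumes "f differentiable (at r)"
  shows "(f has_derivative (\<lambda>h. deriv f r * h)) (at r)" "partial_deriv 1 f r = deriv f r"
proof -
  show "(f has_derivative (\<lambda>h. deriv f r * h)) (at r)"
    using assms unfolding DERIV_deriv_iff_real_differentiable[symmetric] has_field_derivative_def .
  from partial_deriv_eq[OF this] show "partial_deriv 1 f r = deriv f r" by simp
qed

lemma smooth_on_deriv:
  fixes f :: "real \<Rightarrow> real"
  assumes "open S" "smooth_on S f"
  shows "smooth_on S (deriv f)"
  by (rule smooth_on_cong[OF assms(1) _ smooth_on_partial_deriv[OF assms(2), of 1]])
    (auto simp: partial_deriv_eq_deriv smooth_on_differentiable[OF assms(2)])

lemma radial_has_derivative:
  fixes x :: "'a::euclidean_space" and V :: "real \<Rightarrow> real"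
  assumes "V differentiable (at (norm x))" "x \<noteq> 0"
  shows "((\<lambda>y. V (norm y)) has_derivative
    (\<lambda>h. deriv V (norm x) * ((x \<bullet> h) / norm x))) (at x)"
proof -
  have "(norm has_derivative (\<lambda>h. h \<bullet> sgn x)) (at x)"
    using assms(2) by (rule has_derivative_norm)
  from has_derivative_compose[OF this partial_deriv_eq_deriv(1)[OF assms(1)]]
  show ?thesis
    by (simp add: sgn_div_norm inner_commute divide_inverse mult_ac)
qed

text \<open>
  Each partial derivative of a radial function is a radial function times a coordinate; the induction
  works because the profile \<open>V' / r\<close> of that radial function is smooth again.
\<close>

lemma smooth_on_radial:
  fixes V :: "real \<Rightarrow> real"
  assumes "smooth_on {0<..} V"
  shows "smooth_on (- {0}) (\<lambda>x::'a::euclidean_space. V (norm x))"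
  unfolding smooth_on_def
proof
  fix n
  show "Ck_on n (- {0}) (\<lambda>x::'a. V (norm x))"
    using assms
  proof (induction n arbitrary: V)
    case 0
    then have "continuous_on {0<..} V" by (rule smooth_on_continuous)
    then have "continuous_on (- {0}) (\<lambda>x::'a. V (norm x))"
      by (rule continuous_on_compose2) (auto intro!: continuous_intros)
    then show ?case by simp
  next
    case (Suc n)
    have D: "((\<lambda>y. V (norm y)) has_derivative
        (\<lambda>h. deriv V (norm x) * ((x \<bullet> h) / norm x))) (at x)" if "x \<noteq> 0" for x :: 'a
      using that smooth_on_differentiable[OF Suc.prems] by (intro radial_has_derivative) auto
    have "Ck_on n (- {0}) (partial_deriv b (\<lambda>x::'a. V (norm x)))" for b
    proof (rule Ck_on_cong)
      have "smooth_on {0<..} (\<lambda>r. deriv V r * inverse r)"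
        using Suc.prems by (intro smooth_on_mult smooth_on_deriv smooth_on_inverse_pos) auto
      then show "Ck_on n (- {0}) (\<lambda>x. (deriv V (norm x) * inverse (norm x)) * (x \<bullet> b))"
        by (intro Ck_on_bilinear[OF _ bounded_bilinear_mult] Suc.IH)
          (use smooth_on_bounded_linear[OF bounded_linear_inner_left] in \<open>auto simp: smooth_on_def\<close>)
    qed (auto simp: partial_deriv_eq[OF D] divide_inverse)
    then show ?case using D by (auto simp: differentiable_def)
  qed
qed

section \<open>Symmetry of second partial derivatives\<close>

lemma second_difference_mean_value:
  fixes f :: "'a::real_normed_vector \<Rightarrow> real"
  assumes "h > 0"
    and S: "\<And>s t. 0 \<le> s \<Longrightarrow> s \<le> h \<Longrightarrow> 0 \<le> t \<Longrightarrow> t \<le> h \<Longrightarrow> x + s *\<^sub>R u + t *\<^sub>R v \<in> S"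
    and f: "\<And>y. y \<in> S \<Longrightarrow> f differentiable (at y)"
    and f': "\<And>y. y \<in> S \<Longrightarrow> partial_deriv u f differentiable (at y)"
  obtains s t where "0 < s" "s < h" "0 < t" "t < h"
    "f (x + h *\<^sub>R u + h *\<^sub>R v) - f (x + h *\<^sub>R u) - f (x + h *\<^sub>R v) + f x
      = h * (h * partial_deriv v (partial_deriv u f) (x + s *\<^sub>R u + t *\<^sub>R v))"
proof -
  \<comment> \<open>Along a line, partial derivatives become ordinary derivatives in the parameter,
    to which the mean value theorem applies.\<close>
  have line: "((\<lambda>s. g (a + s *\<^sub>R w)) has_real_derivative partial_deriv w g (a + s *\<^sub>R w)) (at s)"
    if "g differentiable (at (a + s *\<^sub>R w))" for g :: "'a \<Rightarrow> real" and a w s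
  proof -
    let ?D = "frechet_derivative g (at (a + s *\<^sub>R w))"
    have "(g has_derivative ?D) (at (a + s *\<^sub>R w))"
      using that frechet_derivative_works by blast
    then have "((\<lambda>s. g (a + s *\<^sub>R w)) has_derivative (\<lambda>k. ?D (k *\<^sub>R w))) (at s)"
      by (rule has_derivative_compose[rotated]) (auto intro!: derivative_eq_intros)
    moreover have "?D (k *\<^sub>R w) = k * ?D w" for k
      using linear_cmul[OF linear_frechet_derivative[OF that]] by simp
    ultimately show ?thesis
      by (simp add: has_field_derivative_def partial_deriv_def mult_commute_abs)
  qed
  \<comment> \<open>The second difference is the increment in direction u of the first difference of
    f in direction v; the mean value theorem is applied to that first difference.\<close>
  have "\<exists>s. 0 < s \<and> s < h \<and> (f ((x + h *\<^sub>R v) + h *\<^sub>R u) - f (x + h *\<^sub>R u))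
      - (f ((x + h *\<^sub>R v) + 0 *\<^sub>R u) - f (x + 0 *\<^sub>R u))
      = (h - 0) * (partial_deriv u f ((x + h *\<^sub>R v) + s *\<^sub>R u) - partial_deriv u f (x + s *\<^sub>R u))"
  proof (rule MVT2[OF assms(1)])
    fix s assume "0 \<le> s" "s \<le> h"
    then have "(x + h *\<^sub>R v) + s *\<^sub>R u \<in> S" "x + s *\<^sub>R u \<in> S"
      using S[of s h] S[of s 0] \<open>h > 0\<close> by (simp_all add: algebra_simps)
    then show "((\<lambda>s. f ((x + h *\<^sub>R v) + s *\<^sub>R u) - f (x + s *\<^sub>R u)) has_real_derivative
        partial_deriv u f ((x + h *\<^sub>R v) + s *\<^sub>R u) - partial_deriv u f (x + s *\<^sub>R u)) (at s)"
      by (intro derivative_intros line f)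
  qed
  then obtain s where s: "0 < s" "s < h"
    "f (x + h *\<^sub>R u + h *\<^sub>R v) - f (x + h *\<^sub>R u) - f (x + h *\<^sub>R v) + f x
      = h * (partial_deriv u f (x + s *\<^sub>R u + h *\<^sub>R v) - partial_deriv u f (x + s *\<^sub>R u + 0 *\<^sub>R v))"
    by (auto simp: algebra_simps)
  \<comment> \<open>A second mean value step, now in direction v, at the s already found.\<close>
  have "\<exists>t. 0 < t \<and> t < h \<and>
      partial_deriv u f (x + s *\<^sub>R u + h *\<^sub>R v) - partial_deriv u f (x + s *\<^sub>R u + 0 *\<^sub>R v)
      = (h - 0) * partial_deriv v (partial_deriv u f) (x + s *\<^sub>R u + t *\<^sub>R v)"
    by (rule MVT2[OF assms(1)]) (use s S f' in \<open>auto intro!: line\<close>)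
  with s that show thesis by auto
qed

text \<open>The second difference of f is symmetric in u and v. It equals h squared times a value of
  either mixed derivative near x, so continuity of both at x forces them to agree.\<close>

lemma partial_deriv_commute_real:
  fixes f :: "'a::euclidean_space \<Rightarrow> real"
  assumes "open S" "smooth_on S f" "x \<in> S" "u \<in> Basis" "v \<in> Basis"
  shows "partial_deriv u (partial_deriv v f) x = partial_deriv v (partial_deriv u f) x" (is "?A x = ?B x")
proof (rule ccontr)
  assume ne: "?A x \<noteq> ?B x"
  \<comment> \<open>With e half the gap, no number lies within e of both \<open>?A x\<close> and
    \<open>?B x\<close>.\<close>
  define e where "e = \<bar>?A x - ?B x\<bar> / 2"
  have e: "e > 0" using ne by (simp add: e_def)
  have sm: "smooth_on S ?A" "smooth_on S ?B"
    using assms by (auto intro: smooth_on_partial_deriv)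
  then have "isCont ?A x" "isCont ?B x"
    using assms smooth_on_continuous continuous_on_eq_continuous_at by blast+
  then have "\<exists>d>0. \<forall>y. dist y x < d \<longrightarrow> dist (?A y) (?A x) < e"
    "\<exists>d>0. \<forall>y. dist y x < d \<longrightarrow> dist (?B y) (?B x) < e"
    using e by (simp_all add: continuous_at_eps_delta)
  then obtain d1 d2 where d: "d1 > 0" "\<And>y. dist y x < d1 \<Longrightarrow> dist (?A y) (?A x) < e"
     "d2 > 0" "\<And>y. dist y x < d2 \<Longrightarrow> dist (?B y) (?B x) < e"
    by auto
  obtain d3 where d3: "d3 > 0" "ball x d3 \<subseteq> S"
    using assms open_contains_ball by blast
  \<comment> \<open>The third makes s + t at most 2 h, which is strictly below all three
    radii.\<close>
  define h where "h = min d1 (min d2 d3) / 3"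
  have h: "h > 0" using d d3 by (simp add: h_def)
  have near: "dist (x + s *\<^sub>R u' + t *\<^sub>R v') x < min d1 (min d2 d3)"
    if "0 \<le> s" "s \<le> h" "0 \<le> t" "t \<le> h" "u' \<in> Basis" "v' \<in> Basis" for s t and u' v' :: 'a
  proof -
    have "dist (x + s *\<^sub>R u' + t *\<^sub>R v') x = norm (s *\<^sub>R u' + t *\<^sub>R v')"
      by (simp add: dist_norm algebra_simps)
    also have "\<dots> \<le> s + t"
      using norm_triangle_ineq[of "s *\<^sub>R u'" "t *\<^sub>R v'"] that by simp
    finally show ?thesis using that h unfolding h_def by linarith
  qed
  have S: "x + s *\<^sub>R u' + t *\<^sub>R v' \<in> S"
    if "0 \<le> s" "s \<le> h" "0 \<le> t" "t \<le> h" "u' \<in> Basis" "v' \<in> Basis" for s t u' v'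
    using near[OF that] d3 by (auto simp: dist_commute subset_eq)
  have df: "f differentiable (at y)" "partial_deriv u f differentiable (at y)"
      "partial_deriv v f differentiable (at y)" if "y \<in> S" for y
    using that assms by (auto intro: smooth_on_differentiable smooth_on_partial_deriv)
  obtain s t where st: "0 < s" "s < h" "0 < t" "t < h"
    "f (x + h *\<^sub>R u + h *\<^sub>R v) - f (x + h *\<^sub>R u) - f (x + h *\<^sub>R v) + f x
      = h * (h * ?B (x + s *\<^sub>R u + t *\<^sub>R v))"
    using second_difference_mean_value[OF h S[of _ _ u v] df(1,2)] assms(4,5) by blast
  obtain s' t' where st': "0 < s'" "s' < h" "0 < t'" "t' < h"
    "f (x + h *\<^sub>R v + h *\<^sub>R u) - f (x + h *\<^sub>R v) - f (x + h *\<^sub>R u) + f x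
      = h * (h * ?A (x + s' *\<^sub>R v + t' *\<^sub>R u))"
    using second_difference_mean_value[OF h S[of _ _ v u] df(1,3)] assms(4,5) by blast
  have "?B (x + s *\<^sub>R u + t *\<^sub>R v) = ?A (x + s' *\<^sub>R v + t' *\<^sub>R u)"
  proof -
    have "x + h *\<^sub>R u + h *\<^sub>R v = x + h *\<^sub>R v + h *\<^sub>R u" by simp
    then have "h * (h * ?B (x + s *\<^sub>R u + t *\<^sub>R v)) = h * (h * ?A (x + s' *\<^sub>R v + t' *\<^sub>R u))"
      using st(5) st'(5) by (simp only:)
    with h show ?thesis by simp
  qed
  moreover have "dist (?B (x + s *\<^sub>R u + t *\<^sub>R v)) (?B x) < e"
    using near[of s t u v] st assms by (intro d) auto
  moreover have "dist (?A (x + s' *\<^sub>R v + t' *\<^sub>R u)) (?A x) < e"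
    using near[of s' t' v u] st' assms by (intro d) auto
  ultimately show False unfolding dist_real_def e_def by argo
qed

text \<open>Mean values exist for real functions only, so the claim is reduced to the components of
  f, which are bounded linear images of it.\<close>

lemma partial_deriv_commute:
  fixes f :: "'a::euclidean_space \<Rightarrow> 'b::euclidean_space"
  assumes "open S" "smooth_on S f" "x \<in> S" "u \<in> Basis" "v \<in> Basis"
  shows "partial_deriv u (partial_deriv v f) x = partial_deriv v (partial_deriv u f) x"
proof (rule euclidean_eqI)
  fix c :: 'b assume "c \<in> Basis"
  have 2: "partial_deriv a (partial_deriv b (\<lambda>y. f y \<bullet> c)) x = partial_deriv a (partial_deriv b f) x \<bullet> c"
    if "a \<in> Basis" "b \<in> Basis" for a b
  proof -
    have "partial_deriv a (partial_deriv b (\<lambda>y. f y \<bullet> c)) x = partial_deriv a (\<lambda>y. partial_deriv b f y \<bullet> c) x"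
      using smooth_on_differentiable[OF assms(2)]
      by (intro partial_deriv_cong_open[OF assms(1,3)]
          partial_deriv_bounded_linear(1)[OF bounded_linear_inner_left, of f]) auto
    also have "\<dots> = partial_deriv a (partial_deriv b f) x \<bullet> c"
      using assms that
      by (intro partial_deriv_bounded_linear(1)[OF bounded_linear_inner_left, of "partial_deriv b f"]
          smooth_on_differentiable smooth_on_partial_deriv)
    finally show ?thesis .
  qed
  have "smooth_on S (\<lambda>y. f y \<bullet> c)"
    by (rule smooth_on_compose_bounded_linear[OF assms(1) bounded_linear_inner_left assms(2)])
  from partial_deriv_commute_real[OF assms(1) this assms(3-5)] 2 assms
  show "partial_deriv u (partial_deriv v f) x \<bullet> c = partial_deriv v (partial_deriv u f) x \<bullet> c" by simp
qed

section \<open>Spin matrices\<close>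

lemma sum_UNIV_2_2: "sum f (UNIV :: (2 \<times> 2) set) = f (1, 1) + f (1, 2) + f (2, 1) + f (2, 2)"
  for f :: "2 \<times> 2 \<Rightarrow> 'a::comm_monoid_add"
  unfolding UNIV_Times_UNIV[symmetric] sum.cartesian_product' by (simp add: sum_2 ac_simps)

lemma vec_eq_2_2_iff:
  "(u :: 'a^(2 \<times> 2)) = v \<longleftrightarrow> u $ (1, 1) = v $ (1, 1) \<and> u $ (1, 2) = v $ (1, 2) \<and>
    u $ (2, 1) = v $ (2, 1) \<and> u $ (2, 2) = v $ (2, 2)"
  by (simp add: vec_eq_iff forall_2)

abbreviation spin1 :: "3 \<Rightarrow> complex^(2 \<times> 2)^(2 \<times> 2)" where
  "spin1 k \<equiv> kronecker (pauli k) (mat 1)"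

abbreviation spin2 :: "3 \<Rightarrow> complex^(2 \<times> 2)^(2 \<times> 2)" where
  "spin2 k \<equiv> kronecker (mat 1) (pauli k)"

lemma index_3: "(1::3) + 1 = 2" "(1::3) + 2 = 3" "(2::3) + 1 = 3" "(2::3) + 2 = 1"
   "(3::3) + 1 = 1" "(3::3) + 2 = 2"
  by simp_all

text \<open>With these rules and those for the second spin, the matrix identities below become
  scalar identities in the entries of the vectors, settled by ring normalisation.\<close>

lemma spin1_component:
  "(spin1 1 *v u) $ (1, b) = u $ (2, b)" "(spin1 1 *v u) $ (2, b) = u $ (1, b)"
  "(spin1 2 *v u) $ (1, b) = - \<i> * u $ (2, b)" "(spin1 2 *v u) $ (2, b) = \<i> * u $ (1, b)"
  "(spin1 3 *v u) $ (1, b) = u $ (1, b)" "(spin1 3 *v u) $ (2, b) = - (u $ (2, b))"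
  using exhaust_2[of b]
  by (auto simp: matrix_vector_mult_def kronecker_def mat_def pauli_def sum_UNIV_2_2)

lemma spin2_component:
  "(spin2 1 *v u) $ (a, 1) = u $ (a, 2)" "(spin2 1 *v u) $ (a, 2) = u $ (a, 1)"
  "(spin2 2 *v u) $ (a, 1) = - \<i> * u $ (a, 2)" "(spin2 2 *v u) $ (a, 2) = \<i> * u $ (a, 1)"
  "(spin2 3 *v u) $ (a, 1) = u $ (a, 1)" "(spin2 3 *v u) $ (a, 2) = - (u $ (a, 2))"
  using exhaust_2[of a]
  by (auto simp: matrix_vector_mult_def kronecker_def mat_def pauli_def sum_UNIV_2_2)

definition spin_diff :: "3 \<Rightarrow> complex^(2 \<times> 2)^(2 \<times> 2)" where
  "spin_diff k = spin1 k - spin2 k"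

definition spin_cross :: "3 \<Rightarrow> complex^(2 \<times> 2)^(2 \<times> 2)" where
  "spin_cross k = spin1 (k + 1) ** spin2 (k + 2) - spin1 (k + 2) ** spin2 (k + 1)"

lemma spin_diff_mult: "spin_diff k *v u = spin1 k *v u - spin2 k *v u"
  by (simp add: spin_diff_def matrix_vector_mult_diff_rdistrib)

lemma spin_cross_mult:
  "spin_cross k *v u = spin1 (k + 1) *v (spin2 (k + 2) *v u) - spin1 (k + 2) *v (spin2 (k + 1) *v u)"
  by (simp add: spin_cross_def matrix_vector_mult_diff_rdistrib matrix_vector_mul_assoc)

text \<open>Here w stands for the second partial derivatives. Its symmetry leaves only symmetrised
  products of the \<open>spin_diff\<close> components: the products within one spin give the
  Laplacian, the mixed ones the V4 term.\<close>

lemma spin_square_second: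
  fixes w :: "3 \<Rightarrow> 3 \<Rightarrow> complex^(2 \<times> 2)"
  assumes "\<And>j k. w j k = w k j"
  shows "(\<Sum>j\<in>UNIV. spin_diff j *v (\<Sum>k\<in>UNIV. spin_diff k *v w j k))
    = (\<Sum>k\<in>UNIV. 2 *s w k k) - 2 *s (\<Sum>j\<in>UNIV. spin1 j *v (\<Sum>k\<in>UNIV. spin2 k *v w j k))"
  unfolding sum_3 spin_diff_mult vec_eq_2_2_iff assms[of 2 1] assms[of 3 1] assms[of 3 2]
  by (simp add: spin1_component spin2_component algebra_simps)

text \<open>The coefficient of x k times v j is the anticommutator of \<open>spin_diff j\<close> and
  \<open>spin_cross k\<close>. It is antisymmetric in j and k, so with v the gradient only
  components of x cross v survive: the spin-orbit term.\<close>

lemma spin_square_first: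
  fixes v :: "3 \<Rightarrow> complex^(2 \<times> 2)"
  shows "(\<Sum>j\<in>UNIV. spin_diff j *v (\<Sum>k\<in>UNIV. x k *s (spin_cross k *v v j)))
      + (\<Sum>j\<in>UNIV. x j *s (spin_cross j *v (\<Sum>k\<in>UNIV. spin_diff k *v v k)))
    = 2 *s (\<Sum>k\<in>UNIV. (spin1 k + spin2 k) *v (x (k + 1) *s v (k + 2) - x (k + 2) *s v (k + 1)))"
  unfolding sum_3 spin_diff_mult spin_cross_mult vec_eq_2_2_iff index_3 matrix_vector_mult_add_rdistrib
  by (simp add: spin1_component spin2_component algebra_simps)

text \<open>The three sources of terms without derivatives of the field: differentiating a
  coordinate, differentiating the radial profile, and squaring the \<open>spin_cross\<close> part.
  The first two feed V2 and V3, the last feeds V0 and V3.\<close>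

lemma spin_square_zeroth:
  fixes u :: "complex^(2 \<times> 2)"
  shows "(\<Sum>j\<in>UNIV. spin_diff j *v (spin_cross j *v u)) = 4 * \<i> *s (\<Sum>k\<in>UNIV. spin1 k *v (spin2 k *v u))"
    and "(\<Sum>j\<in>UNIV. spin_diff j *v (\<Sum>k\<in>UNIV. x j * x k *s (spin_cross k *v u)))
      = 2 * \<i> *s ((\<Sum>k\<in>UNIV. (x k)\<^sup>2) *s (\<Sum>k\<in>UNIV. spin1 k *v (spin2 k *v u))
        - (\<Sum>j\<in>UNIV. x j *s (spin1 j *v (\<Sum>k\<in>UNIV. x k *s (spin2 k *v u)))))"
    and "(\<Sum>j\<in>UNIV. x j *s (spin_cross j *v (\<Sum>k\<in>UNIV. x k *s (spin_cross k *v u))))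
      = 2 *s ((\<Sum>k\<in>UNIV. (x k)\<^sup>2) *s u
        - (\<Sum>j\<in>UNIV. x j *s (spin1 j *v (\<Sum>k\<in>UNIV. x k *s (spin2 k *v u)))))"
  unfolding sum_3 spin_diff_mult spin_cross_mult vec_eq_2_2_iff index_3
  by (simp_all add: spin1_component spin2_component algebra_simps power2_eq_square)


text \<open>As q is twice the exchange of the tensor factors, its square is 4, and it anticommutes
  with both vectors since they change sign under exchange.\<close>

lemma spin_dot_succ_mult:
  fixes u :: "complex^(2 \<times> 2)"
  defines "q \<equiv> (\<Sum>k\<in>UNIV. spin1 k ** spin2 k) + mat 1"
  shows "q *v u = (\<Sum>k\<in>UNIV. spin1 k *v (spin2 k *v u)) + u"
    and "q *v (q *v u) = 4 *s u"
    and "q *v (spin_diff k *v u) = 2 * \<i> *s (spin_cross k *v u)"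
    and "q *v (spin_cross k *v u) = - 2 * \<i> *s (spin_diff k *v u)"
    and "spin_diff k *v (q *v u) = - (q *v (spin_diff k *v u))"
    and "spin_cross k *v (q *v u) = - (q *v (spin_cross k *v u))"
proof -
  show q: "q *v u = (\<Sum>k\<in>UNIV. spin1 k *v (spin2 k *v u)) + u" for u
    by (simp add: q_def sum_3 matrix_vector_mult_add_rdistrib matrix_vector_mul_assoc)
  \<comment> \<open>Only for a concrete k do k + 1 and k + 2 reduce to concrete indices modulo
    3.\<close>
  consider "k = 1" | "k = 2" | "k = 3" using exhaust_3 by blast
  then show "q *v (spin_diff k *v u) = 2 * \<i> *s (spin_cross k *v u)"
    "q *v (spin_cross k *v u) = - 2 * \<i> *s (spin_diff k *v u)"
    "spin_diff k *v (q *v u) = - (q *v (spin_diff k *v u))"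
    "spin_cross k *v (q *v u) = - (q *v (spin_cross k *v u))"
    unfolding q sum_3 spin_diff_mult spin_cross_mult vec_eq_2_2_iff
    by (cases; simp only: index_3; simp add: spin1_component spin2_component algebra_simps)+
  show "q *v (q *v u) = 4 *s u"
    unfolding q sum_3 vec_eq_2_2_iff by (simp add: spin1_component spin2_component)
qed

section \<open>Smooth operators\<close>

text \<open>Derivatives are real-linear while fields are scaled by complex numbers. Real bilinearity
  of \<open>*s\<close> brings complex coefficients under the product rule.\<close>

lemma bounded_bilinear_vector_scalar_mult:
  "bounded_bilinear ((*s) :: complex \<Rightarrow> complex^'n \<Rightarrow> complex^'n)"
  unfolding bilinear_conv_bounded_bilinear[symmetric] bilinear_def linear_iff
  by (auto simp: vec_eq_iff algebra_simps scaleR_conv_of_real[where 'a = complex])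

lemma bounded_linear_vector_scalar_mult: "bounded_linear ((*s) c :: complex^'n \<Rightarrow> _)" for c :: complex
  by (rule bounded_bilinear.bounded_linear_right[OF bounded_bilinear_vector_scalar_mult])

lemma open_punctured: "open (- {0 :: real^3})"
  by auto

lemmas smooth_field_add = smooth_on_add[OF open_punctured]
lemmas smooth_field_scale = smooth_on_compose_bounded_linear[OF open_punctured bounded_linear_vector_scalar_mult]
lemmas smooth_field_matrix = smooth_on_compose_bounded_linear[OF open_punctured matrix_vector_mul_bounded_linear]

lemma smooth_field_partial_op: "smooth_field \<psi> \<Longrightarrow> smooth_field (partial_op k \<psi>)"
  unfolding partial_op_def by (intro smooth_on_partial_deriv) (auto simp: axis_in_Basis_iff)

lemma smooth_field_differentiable: "smooth_field \<psi> \<Longrightarrow> x \<noteq> 0 \<Longrightarrow> \<psi> differentiable (at x)"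
  by (rule smooth_on_differentiable) auto

lemma smooth_operatorI:
  assumes "\<And>\<phi> \<psi> x. smooth_field \<phi> \<Longrightarrow> smooth_field \<psi> \<Longrightarrow> (\<And>y. y \<noteq> 0 \<Longrightarrow> \<phi> y = \<psi> y) \<Longrightarrow> x \<noteq> 0
      \<Longrightarrow> A \<phi> x = A \<psi> x"
    and "\<And>\<psi>. smooth_field \<psi> \<Longrightarrow> smooth_field (A \<psi>)"
    and "\<And>\<phi> \<psi> x. smooth_field \<phi> \<Longrightarrow> smooth_field \<psi> \<Longrightarrow> x \<noteq> 0 \<Longrightarrow> A (\<lambda>y. \<phi> y + \<psi> y) x = A \<phi> x + A \<psi> x"
    and "\<And>c \<psi> x. smooth_field \<psi> \<Longrightarrow> x \<noteq> 0 \<Longrightarrow> A (\<lambda>y. c *s \<psi> y) x = c *s A \<psi> x"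
  shows "smooth_operator A"
  using assms unfolding smooth_operator_def plus_fun_def by blast

lemma smooth_operatorD:
  assumes "smooth_operator A"
  shows "smooth_field \<phi> \<Longrightarrow> smooth_field \<psi> \<Longrightarrow> (\<And>y. y \<noteq> 0 \<Longrightarrow> \<phi> y = \<psi> y) \<Longrightarrow> x \<noteq> 0
      \<Longrightarrow> A \<phi> x = A \<psi> x"
    and "smooth_field \<psi> \<Longrightarrow> smooth_field (A \<psi>)"
    and "smooth_field \<phi> \<Longrightarrow> smooth_field \<psi> \<Longrightarrow> x \<noteq> 0 \<Longrightarrow> A (\<lambda>y. \<phi> y + \<psi> y) x = A \<phi> x + A \<psi> x"
    and "smooth_field \<psi> \<Longrightarrow> x \<noteq> 0 \<Longrightarrow> A (\<lambda>y. c *s \<psi> y) x = c *s A \<psi> x"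
proof -
  note A = assms[unfolded smooth_operator_def plus_fun_def]
  show "smooth_field \<phi> \<Longrightarrow> smooth_field \<psi> \<Longrightarrow> (\<And>y. y \<noteq> 0 \<Longrightarrow> \<phi> y = \<psi> y) \<Longrightarrow> x \<noteq> 0
      \<Longrightarrow> A \<phi> x = A \<psi> x"
    using A[THEN conjunct1, rule_format, of \<phi> \<psi> x] by blast
  show "smooth_field \<psi> \<Longrightarrow> smooth_field (A \<psi>)"
    using A[THEN conjunct2, THEN conjunct1, rule_format] .
  show "smooth_field \<phi> \<Longrightarrow> smooth_field \<psi> \<Longrightarrow> x \<noteq> 0 \<Longrightarrow> A (\<lambda>y. \<phi> y + \<psi> y) x = A \<phi> x + A \<psi> x"
    using A[THEN conjunct2, THEN conjunct2, THEN conjunct1, rule_format] .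
  show "smooth_field \<psi> \<Longrightarrow> x \<noteq> 0 \<Longrightarrow> A (\<lambda>y. c *s \<psi> y) x = c *s A \<psi> x"
    using A[THEN conjunct2, THEN conjunct2, THEN conjunct2, rule_format] .
qed

section \<open>Closure of smooth operators\<close>

lemma smooth_operator_add:
  assumes "smooth_operator A" "smooth_operator B"
  shows "smooth_operator (A + B)"
  by (rule smooth_operatorI)
    (auto simp: smooth_operatorD(3,4)[OF assms(1)] smooth_operatorD(3,4)[OF assms(2)] vector_add_ldistrib
      plus_fun_def intro!: smooth_field_add smooth_operatorD(2)[OF assms(1)] smooth_operatorD(2)[OF assms(2)]
      arg_cong2[where f = "(+)"] smooth_operatorD(1)[OF assms(1)] smooth_operatorD(1)[OF assms(2)])

lemma smooth_operator_compose:
  assumes "smooth_operator A" "smooth_operator B"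
  shows "smooth_operator (A \<odot> B)"
proof (rule smooth_operatorI; unfold comp_def)
  note [simp] = smooth_field_add smooth_field_scale
    smooth_operatorD(2)[OF assms(1)] smooth_operatorD(2)[OF assms(2)]
  show "A (B \<phi>) x = A (B \<psi>) x"
    if "smooth_field \<phi>" "smooth_field \<psi>" "\<And>y. y \<noteq> 0 \<Longrightarrow> \<phi> y = \<psi> y" "x \<noteq> 0" for \<phi> \<psi> x
    by (rule smooth_operatorD(1)[OF assms(1)])
      (simp_all add: that smooth_operatorD(1)[OF assms(2) that(1,2,3)])
  show "smooth_field (A (B \<psi>))" if "smooth_field \<psi>" for \<psi>
    using that by simp
  show "A (B (\<lambda>y. \<phi> y + \<psi> y)) x = A (B \<phi>) x + A (B \<psi>) x"
    if "smooth_field \<phi>" "smooth_field \<psi>" "x \<noteq> 0" for \<phi> \<psi> x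
  proof -
    \<comment> \<open>Additivity of B holds only away from the origin. It may be used under A
      because A ignores the value at the origin.\<close>
    have "A (B (\<lambda>y. \<phi> y + \<psi> y)) x = A (\<lambda>y. B \<phi> y + B \<psi> y) x"
      by (rule smooth_operatorD(1)[OF assms(1)]) (simp_all add: that smooth_operatorD(3)[OF assms(2)])
    then show ?thesis using that by (simp add: smooth_operatorD(3)[OF assms(1)])
  qed
  show "A (B (\<lambda>y. c *s \<psi> y)) x = c *s A (B \<psi>) x"
    if "smooth_field \<psi>" "x \<noteq> 0" for c \<psi> x
  proof -
    have "A (B (\<lambda>y. c *s \<psi> y)) x = A (\<lambda>y. c *s B \<psi> y) x"
      by (rule smooth_operatorD(1)[OF assms(1)]) (simp_all add: that smooth_operatorD(4)[OF assms(2)])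
    then show ?thesis using that by (simp add: smooth_operatorD(4)[OF assms(1)])
  qed
qed

lemma smooth_operator_mult:
  assumes "smooth_on (- {0}) g"
  shows "smooth_operator (mult_op g)"
  by (rule smooth_operatorI)
    (auto simp: mult_op_def[abs_def] vector_add_ldistrib vector_smult_assoc mult.commute
      intro!: smooth_on_bilinear[OF open_punctured bounded_bilinear_vector_scalar_mult] assms)

lemma smooth_operator_matrix: "smooth_operator (matrix_op M)"
  by (rule smooth_operatorI)
    (auto simp: matrix_op_def[abs_def] matrix_vector_right_distrib vector_scalar_commute smooth_field_matrix)

lemma smooth_operator_partial: "smooth_operator (partial_op k)"
proof (rule smooth_operatorI)
  note [simp] = smooth_field_differentiable
  show "partial_op k \<phi> x = partial_op k \<psi> x"
    if "\<And>y. y \<noteq> 0 \<Longrightarrow> \<phi> y = \<psi> y" "x \<noteq> 0" for \<phi> \<psi> x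
    unfolding partial_op_def using that by (intro partial_deriv_cong_open[OF open_punctured]) auto
  show "smooth_field (partial_op k \<psi>)" if "smooth_field \<psi>" for \<psi>
    using that by (rule smooth_field_partial_op)
  show "partial_op k (\<lambda>y. \<phi> y + \<psi> y) x = partial_op k \<phi> x + partial_op k \<psi> x"
    if "smooth_field \<phi>" "smooth_field \<psi>" "x \<noteq> 0" for \<phi> \<psi> x
    using that by (simp add: partial_op_def partial_deriv_add)
  show "partial_op k (\<lambda>y. c *s \<psi> y) x = c *s partial_op k \<psi> x"
    if "smooth_field \<psi>" "x \<noteq> 0" for c \<psi> x
    using that by (simp add: partial_op_def partial_deriv_bounded_linear(1)[OF bounded_linear_vector_scalar_mult])
qed

lemma smooth_operator_const: "smooth_operator (const_op c)"
  by (intro smooth_operator_mult smooth_on_const)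

lemma smooth_operator_diff:
  assumes "smooth_operator A" "smooth_operator B"
  shows "smooth_operator (A - B)"
proof -
  have "A - B = A + const_op (- 1) \<odot> B"
    by (auto simp: fun_eq_iff mult_op_def vec_eq_iff)
  show ?thesis
    unfolding \<open>A - B = _\<close>
    by (intro assms smooth_operator_add smooth_operator_compose smooth_operator_const)
qed

lemma smooth_operator_radial: "smooth_on {0<..} V \<Longrightarrow> smooth_operator (radial_op V)"
  by (intro smooth_operator_mult smooth_on_compose_bounded_linear[OF open_punctured bounded_linear_of_real]
      smooth_on_radial)

lemma smooth_operator_dot:
  "(\<And>k. smooth_operator (A k)) \<Longrightarrow> (\<And>k. smooth_operator (B k)) \<Longrightarrow> smooth_operator (dot_op A B)"
  unfolding dot_op_def sum_3 by (intro smooth_operator_add smooth_operator_compose)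

lemma smooth_operator_cross:
  "(\<And>k. smooth_operator (A k)) \<Longrightarrow> (\<And>k. smooth_operator (B k)) \<Longrightarrow> smooth_operator (cross_op A B k)"
  unfolding cross_op_def by (intro smooth_operator_diff smooth_operator_compose)

lemma smooth_operator_position: "smooth_operator (position k)"
  unfolding position_def
  by (intro smooth_operator_mult smooth_on_compose_bounded_linear[OF open_punctured bounded_linear_of_real]
      smooth_on_bounded_linear bounded_linear_vec_nth)

lemma smooth_operator_momentum: "smooth_operator (momentum hbar k)"
  unfolding momentum_def by (intro smooth_operator_compose smooth_operator_const smooth_operator_partial)

lemma smooth_operator_sigma: "smooth_operator (sigma1 k)" "smooth_operator (sigma2 k)"
  unfolding sigma1_def sigma2_def by (rule smooth_operator_matrix)+

lemma smooth_operator_sigma_add: "smooth_operator ((sigma1 + sigma2) k)"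
  unfolding plus_fun_apply[of sigma1 sigma2 k] by (intro smooth_operator_add smooth_operator_sigma)

lemma smooth_operator_sigma_diff:
  "smooth_operator ((sigma1 - sigma2) k)" "smooth_operator ((sigma2 - sigma1) k)"
  unfolding minus_apply[of sigma1 sigma2 k] minus_apply[of sigma2 sigma1 k]
  by (intro smooth_operator_diff smooth_operator_sigma)+

lemma smooth_operator_laplacian: "smooth_operator laplacian"
  unfolding laplacian_def sum_3
  by (intro smooth_operator_add smooth_operator_compose smooth_operator_partial)

lemmas smooth_operator_intros = smooth_operator_add smooth_operator_compose smooth_operator_dot
  smooth_operator_cross smooth_operator_position smooth_operator_momentum smooth_operator_sigma
  smooth_operator_sigma_add smooth_operator_sigma_diff smooth_operator_laplacian
  smooth_operator_const smooth_operator_radial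

lemma smooth_operator_hamiltonian:
  assumes "smooth_on {0<..} V0" "smooth_on {0<..} V1" "smooth_on {0<..} V2"
    "smooth_on {0<..} V3" "smooth_on {0<..} V4"
  shows "smooth_operator (hamiltonian hbar V0 V1 V2 V3 V4)"
  unfolding hamiltonian_def angular_momentum_def by (intro smooth_operator_intros assms)

lemma smooth_operator_Y_P33:
  assumes "smooth_on {0<..} f2"
  shows "smooth_operator (Y_P33 hbar d10 f2)"
proof -
  have "smooth_on {0<..} (\<lambda>r. f2 r / d10)"
    unfolding divide_inverse by (intro smooth_on_mult assms smooth_on_const) auto
  then show ?thesis unfolding Y_P33_def by (intro smooth_operator_intros)
qed

lemma smooth_operator_spin_spin: "smooth_operator spin_spin"
  unfolding spin_spin_def by (intro smooth_operator_intros)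

section \<open>The first-order integral and its square\<close>

text \<open>For v the gradient of a field, this is the derivative part of Y33 without its factor -i
  hbar / 2. Taking v as a plain triple separates the matrix algebra from the
  differentiation.\<close>

definition dirac_sum :: "(3 \<Rightarrow> complex^(2 \<times> 2)) \<Rightarrow> complex^(2 \<times> 2)" where
  "dirac_sum v = (\<Sum>k\<in>UNIV. spin_diff k *v v k)"

text \<open>For c the coordinates of x, this gives the derivative-free part of Y33 up to its radial
  factor. General c also covers the products x_j x_k that differentiation produces.\<close>

definition cross_sum :: "(3 \<Rightarrow> complex) \<Rightarrow> complex^(2 \<times> 2) \<Rightarrow> complex^(2 \<times> 2)" where
  "cross_sum c u = (\<Sum>k\<in>UNIV. c k *s (spin_cross k *v u))"

lemma vector_scalar_sum: "a *s (\<Sum>k\<in>S. f k) = (\<Sum>k\<in>S. a *s f k :: complex^'n)"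
  by (simp add: vec_eq_iff sum_distrib_left)

lemma dirac_sum_linear:
  "dirac_sum (\<lambda>k. v k + w k) = dirac_sum v + dirac_sum w"
  "dirac_sum (\<lambda>k. a *s v k) = a *s dirac_sum v"
  by (simp_all add: dirac_sum_def matrix_vector_right_distrib sum.distrib vector_scalar_commute vector_scalar_sum)

lemma cross_sum_linear:
  "cross_sum c (u + v) = cross_sum c u + cross_sum c v"
  "cross_sum c (a *s u) = a *s cross_sum c u"
  by (simp_all add: cross_sum_def matrix_vector_right_distrib sum.distrib vector_scalar_commute
      vector_scalar_sum vector_add_ldistrib mult.commute)

lemma Y_P33_apply:
  "Y_P33 hbar d10 f2 \<psi> x =
    (- \<i> * hbar / 2) *s dirac_sum (\<lambda>k. partial_op k \<psi> x)
    + complex_of_real (f2 (norm x) / d10 / 2) *s cross_sum (\<lambda>k. x $ k) (\<psi> x)"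
proof -
  have "Y_P33 hbar d10 f2 \<psi> x = (1 / 2) *s (dirac_sum (\<lambda>k. (- \<i> * hbar) *s partial_op k \<psi> x)
      + complex_of_real (f2 (norm x) / d10) *s cross_sum (\<lambda>k. x $ k) (\<psi> x))"
    unfolding Y_P33_def dirac_sum_def cross_sum_def sum_3 dot_op_def cross_op_def position_def momentum_def
      sigma1_def sigma2_def spin_diff_mult spin_cross_mult
    by (simp add: mult_op_def matrix_op_def)
  then show ?thesis
    unfolding dirac_sum_linear by (simp add: vector_add_ldistrib vector_smult_assoc)
qed

lemma partial_deriv_sum:
  assumes "\<And>i. i \<in> I \<Longrightarrow> f i differentiable (at x)"
  shows "partial_deriv b (\<lambda>y. \<Sum>i\<in>I. f i y) x = (\<Sum>i\<in>I. partial_deriv b (f i) x)"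
proof -
  have "((\<lambda>y. \<Sum>i\<in>I. f i y) has_derivative (\<lambda>h. \<Sum>i\<in>I. frechet_derivative (f i) (at x) h)) (at x)"
    using assms by (intro has_derivative_sum) (simp add: frechet_derivative_works)
  from partial_deriv_eq[OF this] show ?thesis by (simp add: partial_deriv_def)
qed

lemma partial_op_commute:
  "smooth_field \<psi> \<Longrightarrow> x \<noteq> 0 \<Longrightarrow> partial_op j (partial_op k \<psi>) x = partial_op k (partial_op j \<psi>) x"
  unfolding partial_op_def by (rule partial_deriv_commute[OF open_punctured]) (auto simp: axis_in_Basis_iff)

text \<open>The coefficients of \<open>spin_cross k\<close> in Y33 have the form W. The two
  resulting terms are the inputs of the second and of the first identity in
  \<open>spin_square_zeroth\<close>.\<close>

lemma radial_times_coordinate_derivative: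
  fixes g :: "real \<Rightarrow> real" and x :: "real^3" and j k :: 3
  assumes "g differentiable (at (norm x))" "x \<noteq> 0"
  defines "W \<equiv> (\<lambda>y::real^3. complex_of_real (g (norm y)) * complex_of_real (y $ k))"
  shows "W differentiable (at x)"
    and "partial_deriv (axis j 1) W x =
      complex_of_real (deriv g (norm x) / norm x) * (x $ j * x $ k)
      + complex_of_real (g (norm x)) * (if k = j then 1 else 0)"
proof -
  have "((\<lambda>y. g (norm y) * y $ k) has_derivative (\<lambda>h. g (norm x) * h $ k
      + deriv g (norm x) * ((x \<bullet> h) / norm x) * x $ k)) (at x)"
    by (intro has_derivative_mult radial_has_derivative assms(1,2)
        bounded_linear_imp_has_derivative bounded_linear_vec_nth)
  from bounded_linear.has_derivative[OF bounded_linear_of_real[where 'a = complex] this]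
  have W: "(W has_derivative (\<lambda>h. complex_of_real (g (norm x) * h $ k
      + deriv g (norm x) * ((x \<bullet> h) / norm x) * x $ k))) (at x)"
    by (simp add: W_def)
  then show "W differentiable (at x)" by (rule differentiableI)
  show "partial_deriv (axis j 1) W x =
      complex_of_real (deriv g (norm x) / norm x) * (x $ j * x $ k)
      + complex_of_real (g (norm x)) * (if k = j then 1 else 0)"
    unfolding partial_deriv_eq[OF W] inner_axis by (simp add: axis_def)
qed

lemma partial_op_Y_P33:
  fixes f2 :: "real \<Rightarrow> real"
  assumes "smooth_on {0<..} f2" "smooth_field \<psi>" "x \<noteq> 0"
  shows "partial_op j (Y_P33 hbar d10 f2 \<psi>) x =
    (- \<i> * hbar / 2) *s dirac_sum (\<lambda>k. partial_op j (partial_op k \<psi>) x)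
    + (complex_of_real (deriv f2 (norm x) / (2 * d10 * norm x)) *s cross_sum (\<lambda>k. x $ j * x $ k) (\<psi> x)
    + (complex_of_real (f2 (norm x) / d10 / 2) *s (spin_cross j *v \<psi> x)
    + complex_of_real (f2 (norm x) / d10 / 2) *s cross_sum (\<lambda>k. x $ k) (partial_op j \<psi> x)))"
proof -
  define a where "a = - \<i> * complex_of_real hbar / 2"
  \<comment> \<open>The factor 1/2 is absorbed, so that W k is the full coefficient of
    \<open>spin_cross k\<close> in Y33.\<close>
  define g where "g r = f2 r / d10 / 2" for r
  define W where "W k y = complex_of_real (g (norm y)) * complex_of_real (y $ k)" for k and y :: "real^3"
  have f2: "f2 differentiable (at (norm x))"
    using assms by (intro smooth_on_differentiable) auto
  then have "(f2 has_field_derivative deriv f2 (norm x)) (at (norm x))"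
    using DERIV_deriv_iff_real_differentiable by blast
  from DERIV_cdivide[OF DERIV_cdivide[OF this, of d10], of 2]
  have "(g has_field_derivative (deriv f2 (norm x) / d10 / 2)) (at (norm x))"
    by (simp only: g_def[abs_def])
  then have g: "g differentiable (at (norm x))" "deriv g (norm x) = deriv f2 (norm x) / d10 / 2"
    by (auto simp: DERIV_imp_deriv real_differentiable_def)
  note W = radial_times_coordinate_derivative[OF g(1) assms(3), folded W_def]
  note d = smooth_field_differentiable[OF assms(2,3)]
    smooth_field_differentiable[OF smooth_field_partial_op[OF assms(2)] assms(3)]
  note lin = partial_deriv_bounded_linear[OF matrix_vector_mul_bounded_linear]
    partial_deriv_bounded_linear[OF bounded_linear_vector_scalar_mult]
  note bil = partial_deriv_bilinear[OF bounded_bilinear_vector_scalar_mult]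
  have Y: "Y_P33 hbar d10 f2 \<psi> = (\<lambda>y. a *s (\<Sum>k\<in>UNIV. spin_diff k *v partial_op k \<psi> y)
      + (\<Sum>k\<in>UNIV. W k y *s (spin_cross k *v \<psi> y)))"
    by (simp add: fun_eq_iff Y_P33_apply dirac_sum_def cross_sum_def vector_scalar_sum W_def g_def
        vector_smult_assoc a_def)
  have "partial_op j (Y_P33 hbar d10 f2 \<psi>) x =
      a *s (\<Sum>k\<in>UNIV. spin_diff k *v partial_op j (partial_op k \<psi>) x)
      + (\<Sum>k\<in>UNIV. W k x *s (spin_cross k *v partial_op j \<psi> x)
          + partial_deriv (axis j 1) (W k) x *s (spin_cross k *v \<psi> x))"
    unfolding Y partial_op_def[of j]
    by (simp add: partial_deriv_add partial_deriv_sum differentiable_sum lin bil W(1) d)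
  \<comment> \<open>Differentiating the coordinate x_k in direction j leaves a Kronecker delta,
    which collapses the sum to \<open>spin_cross j\<close>.\<close>
  moreover have delta: "(\<Sum>k\<in>UNIV. (b * (if k = j then 1 else 0)) *s f k) = b *s f j"
    for b and f :: "3 \<Rightarrow> complex^(2 \<times> 2)"
    by (simp add: vec_eq_iff if_distrib[of "\<lambda>c. _ * c"] if_distrib[of "\<lambda>c. c * _"] cong: if_cong)
  ultimately show ?thesis
    unfolding a_def[symmetric] W(2) W_def vector_sadd_rdistrib sum.distrib delta
    by (simp add: g g_def dirac_sum_def cross_sum_def vector_scalar_sum vector_smult_assoc algebra_simps)
qed

text \<open>Brings H to a form sorted by the order of derivatives, ready for comparison of
  coefficients with the square of Y33.\<close>

lemma hamiltonian_apply:
  assumes "smooth_field \<psi>" "x \<noteq> 0"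
  shows "hamiltonian hbar V0 V1 V2 V3 V4 \<psi> x =
    (- (complex_of_real hbar)\<^sup>2 / 2) *s (\<Sum>k\<in>UNIV. partial_op k (partial_op k \<psi>) x)
    + complex_of_real (V0 (norm x)) *s \<psi> x
    + (- \<i> * hbar / 2 * V1 (norm x)) *s (\<Sum>k\<in>UNIV. (spin1 k + spin2 k) *v
        (complex_of_real (x $ (k + 1)) *s partial_op (k + 2) \<psi> x
         - complex_of_real (x $ (k + 2)) *s partial_op (k + 1) \<psi> x))
    + complex_of_real (V2 (norm x)) *s (\<Sum>k\<in>UNIV. spin1 k *v (spin2 k *v \<psi> x))
    + complex_of_real (V3 (norm x)) *s (\<Sum>j\<in>UNIV. complex_of_real (x $ j) *s
        (spin1 j *v (\<Sum>k\<in>UNIV. complex_of_real (x $ k) *s (spin2 k *v \<psi> x))))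
    + (- (complex_of_real hbar)\<^sup>2 * V4 (norm x)) *s (\<Sum>j\<in>UNIV. spin1 j *v
        (\<Sum>k\<in>UNIV. spin2 k *v partial_op j (partial_op k \<psi>) x))"
proof -
  define c where "c = - \<i> * complex_of_real hbar"
  have cc: "c * c = - (complex_of_real hbar)\<^sup>2"
    by (simp add: c_def power2_eq_square algebra_simps)
  note d = smooth_field_differentiable[OF smooth_field_partial_op[OF assms(1)] assms(2)]
  note lin = partial_deriv_bounded_linear[OF matrix_vector_mul_bounded_linear]
    partial_deriv_bounded_linear[OF bounded_linear_vector_scalar_mult]
  \<comment> \<open>In the V4 term the outer momentum differentiates a sum of fields; constant
    matrices and scalars pass through the derivative.\<close>
  have dp: "partial_op j (\<lambda>y. \<Sum>k\<in>UNIV. spin2 k *v (c *s partial_op k \<psi> y)) x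
      = (\<Sum>k\<in>UNIV. spin2 k *v (c *s partial_op j (partial_op k \<psi>) x))" for j
    unfolding partial_op_def[of j] by (simp add: partial_deriv_sum lin d)
  have fun_sum: "(\<lambda>y. \<Sum>k\<in>UNIV. spin2 k *v (c *s partial_op k \<psi> y))
      = dot_op sigma2 (momentum hbar) \<psi>"
    by (simp add: fun_eq_iff dot_op_def sum_3 sigma2_def momentum_def matrix_op_def mult_op_def c_def)
  have pp: "dot_op sigma1 (momentum hbar) (dot_op sigma2 (momentum hbar) \<psi>) x
      = (c * c) *s (\<Sum>j\<in>UNIV. spin1 j *v (\<Sum>k\<in>UNIV. spin2 k *v partial_op j (partial_op k \<psi>) x))"
  proof -
    have "dot_op sigma1 (momentum hbar) (dot_op sigma2 (momentum hbar) \<psi>) x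
      = (\<Sum>j\<in>UNIV. spin1 j *v (c *s partial_op j (dot_op sigma2 (momentum hbar) \<psi>) x))"
      by (simp add: dot_op_def[of sigma1] sum_3 sigma1_def momentum_def matrix_op_def mult_op_def c_def)
    also have "\<dots> = (\<Sum>j\<in>UNIV. spin1 j *v (c *s (\<Sum>k\<in>UNIV. spin2 k *v (c *s partial_op j (partial_op k \<psi>) x))))"
      unfolding fun_sum[symmetric] dp ..
    finally show ?thesis
      by (simp add: vector_scalar_commute vector_smult_assoc flip: vector_scalar_sum)
  qed
  have L: "dot_op (sigma1 + sigma2) (angular_momentum hbar) \<psi> x = c *s (\<Sum>k\<in>UNIV. (spin1 k + spin2 k) *v
        (complex_of_real (x $ (k + 1)) *s partial_op (k + 2) \<psi> x
         - complex_of_real (x $ (k + 2)) *s partial_op (k + 1) \<psi> x))"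
  proof -
    have "dot_op (sigma1 + sigma2) (angular_momentum hbar) \<psi> x = (\<Sum>k\<in>UNIV. (spin1 k + spin2 k) *v
        (complex_of_real (x $ (k + 1)) *s (c *s partial_op (k + 2) \<psi> x)
         - complex_of_real (x $ (k + 2)) *s (c *s partial_op (k + 1) \<psi> x)))"
      unfolding dot_op_def angular_momentum_def cross_op_def sum_3 sigma1_def sigma2_def position_def momentum_def
      by (simp add: matrix_op_def mult_op_def c_def matrix_vector_mult_add_rdistrib)
    also have "\<dots> = c *s (\<Sum>k\<in>UNIV. (spin1 k + spin2 k) *v
        (complex_of_real (x $ (k + 1)) *s partial_op (k + 2) \<psi> x
         - complex_of_real (x $ (k + 2)) *s partial_op (k + 1) \<psi> x))"
      unfolding vector_scalar_sum vector_scalar_commute[symmetric]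
      by (intro sum.cong refl arg_cong2[where f = "(*v)"])
        (simp add: vec_eq_iff algebra_simps)
    finally show ?thesis .
  qed
  have lap: "laplacian \<psi> x = (\<Sum>k\<in>UNIV. partial_op k (partial_op k \<psi>) x)"
    by (simp add: laplacian_def sum_3)
  have K: "dot_op sigma1 sigma2 \<psi> x = (\<Sum>k\<in>UNIV. spin1 k *v (spin2 k *v \<psi> x))"
    by (simp add: dot_op_def sum_3 sigma1_def sigma2_def matrix_op_def)
  have A: "dot_op position sigma1 (dot_op position sigma2 \<psi>) x = (\<Sum>j\<in>UNIV. complex_of_real (x $ j) *s
        (spin1 j *v (\<Sum>k\<in>UNIV. complex_of_real (x $ k) *s (spin2 k *v \<psi> x))))"
    by (simp add: dot_op_def sum_3 sigma1_def sigma2_def position_def mult_op_def matrix_op_def)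
  have "hamiltonian hbar V0 V1 V2 V3 V4 \<psi> x =
      complex_of_real (- (hbar\<^sup>2 / 2)) *s laplacian \<psi> x + complex_of_real (V0 (norm x)) *s \<psi> x
      + (1 / 2) *s (complex_of_real (V1 (norm x)) *s dot_op (sigma1 + sigma2) (angular_momentum hbar) \<psi> x)
      + complex_of_real (V2 (norm x)) *s dot_op sigma1 sigma2 \<psi> x
      + complex_of_real (V3 (norm x)) *s dot_op position sigma1 (dot_op position sigma2 \<psi>) x
      + complex_of_real (V4 (norm x)) *s dot_op sigma1 (momentum hbar) (dot_op sigma2 (momentum hbar) \<psi>) x"
    by (simp add: hamiltonian_def mult_op_def)
  then show ?thesis
    unfolding L pp lap K A cc vector_smult_assoc by (simp add: c_def mult.commute mult.left_commute)
qed

text \<open>The second-order part of the square yields the kinetic and V4 terms, the first-order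
  part V1, and the rest V2, V3 and V0 - d12.\<close>

lemma Y_P33_square:
  fixes f2 :: "real \<Rightarrow> real"
  assumes "d10 \<noteq> 0" "smooth_on {0<..} f2" "smooth_field \<psi>" "x \<noteq> 0"
  shows "Y_P33 hbar d10 f2 (Y_P33 hbar d10 f2 \<psi>) x =
    hamiltonian hbar (\<lambda>r. d12 + r\<^sup>2 * (f2 r)\<^sup>2 / (2 * d10\<^sup>2)) (\<lambda>r. f2 r / d10)
      (\<lambda>r. hbar * (2 * f2 r + r * deriv f2 r) / (2 * d10))
      (\<lambda>r. - ((r * (f2 r)\<^sup>2 + d10 * hbar * deriv f2 r) / (2 * d10\<^sup>2 * r)))
      (\<lambda>r. - (1 / 2)) \<psi> x - complex_of_real d12 *s \<psi> x"
proof -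
  let ?Y = "Y_P33 hbar d10 f2"
  \<comment> \<open>\<alpha> and G are the coefficients at x of the derivative part and of the other
    part of Y33; q is the radial derivative of G divided by r.\<close>
  define \<alpha> where "\<alpha> = - \<i> * complex_of_real hbar / 2"
  define r where "r = norm x"
  define G where "G = complex_of_real (f2 r / d10 / 2)"
  define q where "q = complex_of_real (deriv f2 r / (2 * d10 * r))"
  define X where "X k = complex_of_real (x $ k)" for k
  define u where "u = \<psi> x"
  define v where "v k = partial_op k \<psi> x" for k
  define w where "w j k = partial_op j (partial_op k \<psi>) x" for j k
  define SS where "SS = (\<Sum>j\<in>UNIV. spin1 j *v (\<Sum>k\<in>UNIV. spin2 k *v w j k))"
  define L where "L = (\<Sum>k\<in>UNIV. (spin1 k + spin2 k) *v (X (k + 1) *s v (k + 2) - X (k + 2) *s v (k + 1)))"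
  define A where "A = (\<Sum>j\<in>UNIV. X j *s (spin1 j *v (\<Sum>k\<in>UNIV. X k *s (spin2 k *v u))))"
  define Ku where "Ku = (\<Sum>k\<in>UNIV. spin1 k *v (spin2 k *v u))"
  define Lap where "Lap = (\<Sum>k\<in>UNIV. w k k)"
  have r: "r \<noteq> 0" "(\<Sum>k\<in>UNIV. (X k)\<^sup>2) = (complex_of_real r)\<^sup>2"
  proof -
    show "r \<noteq> 0" using assms by (simp add: r_def)
    have "r\<^sup>2 = (\<Sum>k\<in>UNIV. (x $ k)\<^sup>2)"
      by (simp add: r_def norm_vec_def L2_set_def sum_nonneg)
    then have "(complex_of_real r)\<^sup>2 = complex_of_real (\<Sum>k\<in>UNIV. (x $ k)\<^sup>2)"
      by (metis of_real_power)
    then show "(\<Sum>k\<in>UNIV. (X k)\<^sup>2) = (complex_of_real r)\<^sup>2" by (simp add: X_def)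
  qed
  have w: "w j k = w k j" for j k
    unfolding w_def using assms by (intro partial_op_commute)
  have 2: "dirac_sum (\<lambda>j. dirac_sum (w j)) = 2 *s Lap - 2 *s SS"
    using spin_square_second[OF w] unfolding dirac_sum_def Lap_def SS_def vector_scalar_sum by simp
  have 1: "dirac_sum (\<lambda>j. cross_sum X (v j)) + cross_sum X (dirac_sum v) = 2 *s L"
    using spin_square_first[where x = X and v = v] unfolding dirac_sum_def cross_sum_def L_def by simp
  have 0: "dirac_sum (\<lambda>j. spin_cross j *v u) = (4 * \<i>) *s Ku"
    "dirac_sum (\<lambda>j. cross_sum (\<lambda>k. X j * X k) u) = (2 * \<i>) *s ((complex_of_real r)\<^sup>2 *s Ku - A)"
    "cross_sum X (cross_sum X u) = 2 *s ((complex_of_real r)\<^sup>2 *s u - A)"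
    using spin_square_zeroth(1)[of u] spin_square_zeroth(2,3)[where x = X and u = u]
    unfolding dirac_sum_def cross_sum_def Ku_def A_def r by simp_all
  have "?Y (?Y \<psi>) x = \<alpha> *s dirac_sum (\<lambda>j. partial_op j (?Y \<psi>) x) + G *s cross_sum X (?Y \<psi> x)"
    by (simp add: Y_P33_apply[of _ _ _ "?Y \<psi>"] \<alpha>_def G_def X_def[abs_def] r_def)
  also have "\<dots> = \<alpha> *s dirac_sum (\<lambda>j. \<alpha> *s dirac_sum (w j) + (q *s cross_sum (\<lambda>k. X j * X k) u
      + (G *s (spin_cross j *v u) + G *s cross_sum X (v j)))) + G *s cross_sum X (\<alpha> *s dirac_sum v + G *s cross_sum X u)"
    using partial_op_Y_P33[OF assms(2-4)] Y_P33_apply[of hbar d10 f2 \<psi> x]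
    by (simp add: \<alpha>_def G_def X_def[abs_def] r_def q_def u_def v_def[abs_def] w_def[abs_def])
  \<comment> \<open>The two cross terms with one derivative of the field share the factor \<alpha> *
    G and merge into the left side of fact \<open>1\<close>.\<close>
  also have "\<dots> = (\<alpha> * \<alpha>) *s (2 *s Lap - 2 *s SS) + (\<alpha> * q) *s ((2 * \<i>) *s ((complex_of_real r)\<^sup>2 *s Ku - A))
      + (\<alpha> * G) *s ((4 * \<i>) *s Ku) + (\<alpha> * G) *s (2 *s L) + (G * G) *s (2 *s ((complex_of_real r)\<^sup>2 *s u - A))"
    unfolding dirac_sum_linear cross_sum_linear 2[symmetric] 1[symmetric] 0[symmetric]
    by (simp add: vector_add_ldistrib vector_smult_assoc algebra_simps)
  also have "\<dots> = hamiltonian hbar (\<lambda>r. d12 + r\<^sup>2 * (f2 r)\<^sup>2 / (2 * d10\<^sup>2)) (\<lambda>r. f2 r / d10)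
      (\<lambda>r. hbar * (2 * f2 r + r * deriv f2 r) / (2 * d10))
      (\<lambda>r. - ((r * (f2 r)\<^sup>2 + d10 * hbar * deriv f2 r) / (2 * d10\<^sup>2 * r)))
      (\<lambda>r. - (1 / 2)) \<psi> x - complex_of_real d12 *s \<psi> x"
    unfolding hamiltonian_apply[OF assms(3,4)] r_def[symmetric] X_def[symmetric] u_def[symmetric]
      v_def[symmetric] w_def[symmetric] Lap_def[symmetric] SS_def[symmetric] L_def[symmetric]
      A_def[symmetric] Ku_def[symmetric]
    \<comment> \<open>Comparison of coefficients: for instance \<alpha> * G * 4 * i is hbar f2 /
      d10, the first term of V2.\<close>
    using assms(1) r(1) unfolding vec_eq_iff
    by (auto simp: \<alpha>_def G_def q_def field_simps power2_eq_square)
  finally show ?thesis .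
qed

section \<open>The exchange operator and the second first-order integral\<close>

lemma spin_spin_succ:
  fixes q :: "complex^(2 \<times> 2)^(2 \<times> 2)"
  defines "q \<equiv> (\<Sum>k\<in>UNIV. spin1 k ** spin2 k) + mat 1"
  shows "spin_spin \<psi> x = q *v \<psi> x - \<psi> x"
  unfolding q_def spin_dot_succ_mult(1) by (simp add: spin_spin_def dot_op_def sum_3 sigma1_def sigma2_def matrix_op_def)

text \<open>Multiplication by q turns \<open>spin_diff\<close> into 2 i \<open>spin_cross\<close>
  and \<open>spin_cross\<close> into -2 i \<open>spin_diff\<close>, so the two parts of Y33 become
  those of Y34 with their roles interchanged.\<close>

lemma Y_P34_eq:
  fixes q :: "complex^(2 \<times> 2)^(2 \<times> 2)"
  defines "q \<equiv> (\<Sum>k\<in>UNIV. spin1 k ** spin2 k) + mat 1"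
  assumes "d10 \<noteq> 0"
  shows "Y_P34 hbar d10 f2 \<psi> x = (- \<i> * complex_of_real d10) *s (q *v Y_P33 hbar d10 f2 \<psi> x)"
proof -
  have "Y_P34 hbar d10 f2 \<psi> x = - complex_of_real (f2 (norm x)) *s dirac_sum (\<lambda>k. complex_of_real (x $ k) *s \<psi> x)
      + complex_of_real d10 *s (\<Sum>k\<in>UNIV. spin_cross k *v ((- \<i> * hbar) *s partial_op k \<psi> x))"
    unfolding Y_P34_def dirac_sum_def sum_3 dot_op_def cross_op_def position_def momentum_def
      sigma1_def sigma2_def spin_diff_mult spin_cross_mult
    by (simp add: mult_op_def matrix_op_def vec_eq_iff algebra_simps)
  also have "\<dots> = (- \<i> * complex_of_real d10) *s (q *v Y_P33 hbar d10 f2 \<psi> x)"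
    unfolding Y_P33_apply dirac_sum_def cross_sum_def sum_3 matrix_vector_right_distrib vector_scalar_commute
      spin_dot_succ_mult(3,4)[folded q_def]
    using assms(2) by (simp add: vec_eq_iff field_simps)
  finally show ?thesis .
qed

text \<open>The constant matrix q commutes with derivatives and scalar coefficients and anticommutes
  with both spin vectors.\<close>

lemma Y_P33_anticommute:
  fixes q :: "complex^(2 \<times> 2)^(2 \<times> 2)"
  defines "q \<equiv> (\<Sum>k\<in>UNIV. spin1 k ** spin2 k) + mat 1"
  assumes "smooth_field \<psi>" "x \<noteq> 0"
  shows "Y_P33 hbar d10 f2 (\<lambda>y. q *v \<psi> y) x = - (q *v Y_P33 hbar d10 f2 \<psi> x)"
proof -
  have pd: "partial_op k (\<lambda>y. q *v \<psi> y) x = q *v partial_op k \<psi> x" for k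
    unfolding partial_op_def
    by (intro partial_deriv_bounded_linear(1)[OF matrix_vector_mul_bounded_linear, of \<psi>]
        smooth_field_differentiable assms)
  show ?thesis
    unfolding Y_P33_apply dirac_sum_def cross_sum_def sum_3 pd matrix_vector_right_distrib
      vector_scalar_commute spin_dot_succ_mult(5,6)[folded q_def]
    by (simp add: vec_eq_iff algebra_simps)
qed

lemma matrix_vector_mult_uminus: "A *v (- v) = - (A *v v)" for A :: "complex^'n^'m"
  using matrix_vector_mult_diff_distrib[of A 0 v] by simp

section \<open>The symmetry algebra\<close>

lemma op_eqI: "(\<And>\<psi> x. smooth_field \<psi> \<Longrightarrow> x \<noteq> 0 \<Longrightarrow> A \<psi> x = B \<psi> x) \<Longrightarrow> A \<doteq> B"
  by (simp add: op_eq_def)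

lemma op_eqD: "A \<doteq> B \<Longrightarrow> smooth_field \<psi> \<Longrightarrow> x \<noteq> 0 \<Longrightarrow> A \<psi> x = B \<psi> x"
  by (simp add: op_eq_def)

lemma commutator_apply: "commutator A B \<psi> x = A (B \<psi>) x - B (A \<psi>) x"
  by (simp add: commutator_def)

text \<open>The zero polynomial is obtained as 0 times the monomial with all exponents 0.\<close>

lemma commutator_self_polynomial: "\<exists>P\<in>op_polynomials Gs. commutator A A \<doteq> P"
proof
  have "op_monomial Gs (replicate (length Gs) 0) \<in> op_polynomials Gs"
    by (rule op_polynomials.monomial) simp
  then show "const_op 0 \<odot> op_monomial Gs (replicate (length Gs) 0) \<in> op_polynomials Gs"
    by (rule op_polynomials.scale)
  show "commutator A A \<doteq> const_op 0 \<odot> op_monomial Gs (replicate (length Gs) 0)"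
    by (rule op_eqI) (simp add: commutator_apply mult_op_def vec_eq_iff)
qed

text \<open>Antisymmetry of the commutator: each unordered pair of generators has to be treated in
  one order only.\<close>

lemma commutator_swap_polynomial:
  assumes "P \<in> op_polynomials Gs" "commutator A B \<doteq> P"
  shows "\<exists>P\<in>op_polynomials Gs. commutator B A \<doteq> P"
proof
  show "const_op (- 1) \<odot> P \<in> op_polynomials Gs"
    using assms(1) by (rule op_polynomials.scale)
  show "commutator B A \<doteq> const_op (- 1) \<odot> P"
  proof (rule op_eqI)
    fix \<psi> :: spinor_field and x :: "real^3"
    assume "smooth_field \<psi>" "x \<noteq> 0"
    then have "commutator B A \<psi> x = - P \<psi> x"
      using op_eqD[OF assms(2)] by (metis commutator_apply minus_diff_eq)
    then show "commutator B A \<psi> x = (const_op (- 1) \<odot> P) \<psi> x"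
      by (simp add: mult_op_def vec_eq_iff)
  qed
qed

text \<open>Since H is the square of Y plus a constant, commuting with that square and complex
  linearity suffice.\<close>

lemma integral_of_motion_if_commutes_with_square:
  assumes "smooth_operator A" "smooth_operator Y"
    and H: "\<And>\<psi> x. smooth_field \<psi> \<Longrightarrow> x \<noteq> 0 \<Longrightarrow> H \<psi> x = Y (Y \<psi>) x + c *s \<psi> x"
    and "smooth_operator H"
    and comm: "\<And>\<psi> x. smooth_field \<psi> \<Longrightarrow> x \<noteq> 0 \<Longrightarrow> A (Y (Y \<psi>)) x = Y (Y (A \<psi>)) x"
  shows "integral_of_motion H A"
  unfolding integral_of_motion_def
proof (intro conjI assms(1) op_eqI)
  fix \<psi> :: spinor_field and x :: "real^3"
  assume \<psi>: "smooth_field \<psi>" and x: "x \<noteq> 0"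
  note A = smooth_operatorD[OF assms(1)] and Y = smooth_operatorD(2)[OF assms(2)]
  \<comment> \<open>The formula for H holds away from the origin only; A may be applied to it
    because A ignores the origin.\<close>
  have "A (H \<psi>) x = A (\<lambda>y. Y (Y \<psi>) y + c *s \<psi> y) x"
    using \<psi> x by (intro A(1) H smooth_operatorD(2)[OF assms(4)] smooth_field_add smooth_field_scale Y)
  also have "\<dots> = Y (Y (A \<psi>)) x + c *s A \<psi> x"
    using \<psi> x by (simp add: A(3,4) Y smooth_field_scale comm)
  also have "\<dots> = H (A \<psi>) x" using H[OF A(2)[OF \<psi>] x] by simp
  finally show "commutator H A \<psi> x = 0 \<psi> x" by (simp add: commutator_apply)
qed

theorem proposition7:
  fixes hbar d10 d12 :: real and f2 :: "real \<Rightarrow> real"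
    and V0 V1 V2 V3 V4 :: "real \<Rightarrow> real" and H K Y33 Y34 :: operator
  assumes "hbar > 0" and "d10 \<noteq> 0" and "smooth_on {0<..} f2"
    and "V0 = (\<lambda>r. d12 + r\<^sup>2 * (f2 r)\<^sup>2 / (2 * d10\<^sup>2))"
    and "V1 = (\<lambda>r. f2 r / d10)"
    and "V2 = (\<lambda>r. hbar * (2 * f2 r + r * deriv f2 r) / (2 * d10))"
    and "V3 = (\<lambda>r. - ((r * (f2 r)\<^sup>2 + d10 * hbar * deriv f2 r) / (2 * d10\<^sup>2 * r)))"
    and "V4 = (\<lambda>r. - (1 / 2))"
    and "H = hamiltonian hbar V0 V1 V2 V3 V4"
    and "K = spin_spin"
    and "Y33 = Y_P33 hbar d10 f2"
    and "Y34 = Y_P34 hbar d10 f2"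
  shows "generate_finite_polynomial_symmetry_algebra H [K, Y33, Y34]
    \<and> commutator K Y33 \<doteq> const_op (2 * \<i> / complex_of_real d10) \<odot> Y34
    \<and> commutator K Y34 \<doteq> const_op (- 8 * \<i> * complex_of_real d10) \<odot> Y33
    \<and> commutator Y33 Y34 \<doteq>
        const_op (2 * \<i> * complex_of_real d10) \<odot> (K + id) \<odot> (H - const_op (complex_of_real d12))
    \<and> Y33 \<odot> Y33 \<doteq> H - const_op (complex_of_real d12)
    \<and> Y34 \<odot> Y34 \<doteq> const_op (4 * (complex_of_real d10)\<^sup>2) \<odot> (H - const_op (complex_of_real d12))"
proof -
  define q :: "complex^(2 \<times> 2)^(2 \<times> 2)" where "q = (\<Sum>k\<in>UNIV. spin1 k ** spin2 k) + mat 1"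
  \<comment> \<open>The factor in Y34 = \<beta> q Y33, through which all relations for Y34 reduce to
    relations for q and Y33.\<close>
  define \<beta> where "\<beta> = - \<i> * complex_of_real d10"
  have \<beta>: "2 * \<i> / complex_of_real d10 * \<beta> = 2" "\<beta> * \<beta> = - (complex_of_real d10)\<^sup>2"
    using assms(2) by (simp_all add: \<beta>_def power2_eq_square algebra_simps)
  have qq: "q *v (q *v u) = 4 *s u" for u
    unfolding q_def by (rule spin_dot_succ_mult)
  have K: "K \<psi> x = q *v \<psi> x - \<psi> x" for \<psi> x
    unfolding assms q_def by (rule spin_spin_succ)
  have Y34: "Y34 = (\<lambda>\<psi> x. \<beta> *s (q *v Y33 \<psi> x))"
    unfolding assms q_def \<beta>_def by (intro ext Y_P34_eq assms)
  have anti: "Y33 (\<lambda>y. q *v \<psi> y) x = - (q *v Y33 \<psi> x)" if "smooth_field \<psi>" "x \<noteq> 0" for \<psi> x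
    unfolding assms q_def using that by (rule Y_P33_anticommute)

  \<comment> \<open>Smoothness of the potentials and operators\<close>
  have smooth_V: "smooth_on {0<..} V0" "smooth_on {0<..} V1" "smooth_on {0<..} V2" "smooth_on {0<..} V3"
    "smooth_on {0<..} V4"
  proof -
    have pos: "open {0 :: real<..}" by simp
    note s = smooth_on_const smooth_on_add[OF pos] smooth_on_mult[OF pos] assms(3) smooth_on_deriv[OF pos assms(3)]
      smooth_on_bounded_linear[OF bounded_linear_ident] smooth_on_inverse_pos
    show "smooth_on {0<..} V0" "smooth_on {0<..} V1" "smooth_on {0<..} V2" "smooth_on {0<..} V4"
      unfolding assms(4,5,6,8) divide_inverse power2_eq_square by (intro s)+
    \<comment> \<open>Isolates 1 / r as a factor smooth on the half-line. At r = 0 both sides are 0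
      by the convention for division.\<close>
    have "V3 = (\<lambda>r. (- 1 / (2 * d10\<^sup>2)) * ((r * (f2 r * f2 r) + d10 * hbar * deriv f2 r) * inverse r))"
      unfolding assms(7) by (auto simp: fun_eq_iff power2_eq_square field_simps)
    then show "smooth_on {0<..} V3" by (simp only:) (intro s)
  qed
  have smooth_H: "smooth_operator H"
    unfolding assms(9) by (intro smooth_operator_hamiltonian smooth_V)
  have smooth_Y33: "smooth_operator Y33"
    unfolding assms(11) by (intro smooth_operator_Y_P33 assms)
  have smooth_K: "smooth_operator K"
    unfolding assms(10) by (rule smooth_operator_spin_spin)
  have smooth_Y34: "smooth_operator Y34"
  proof -
    have "Y34 = const_op \<beta> \<odot> matrix_op q \<odot> Y33"
      by (simp add: Y34 fun_eq_iff mult_op_def matrix_op_def)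
    then show ?thesis
      by (simp only:) (intro smooth_operator_compose smooth_operator_const smooth_operator_matrix smooth_Y33)
  qed
  note Y = smooth_operatorD[OF smooth_Y33]

  \<comment> \<open>Products with Y33 on the left\<close>
  have square: "Y33 (Y33 \<psi>) x = H \<psi> x - complex_of_real d12 *s \<psi> x"
    if "smooth_field \<psi>" "x \<noteq> 0" for \<psi> x
    unfolding assms(4-9,11) using assms(2,3) that by (rule Y_P33_square)
  have YK: "Y33 (K \<psi>) x = - (q *v Y33 \<psi> x) - Y33 \<psi> x" if "smooth_field \<psi>" "x \<noteq> 0" for \<psi> x
  proof -
    \<comment> \<open>Adding \<psi> turns K into q, which anticommutes with Y33; additivity then
      isolates the K term.\<close>
    have "Y33 (\<lambda>y. K \<psi> y + \<psi> y) x = - (q *v Y33 \<psi> x)"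
      unfolding K using anti[OF that] by simp
    then show ?thesis
      using Y(3)[OF smooth_operatorD(2)[OF smooth_K that(1)] that] by (simp add: algebra_simps)
  qed
  have YY34: "Y33 (Y34 \<psi>) x = - (\<beta> *s (q *v Y33 (Y33 \<psi>) x))" if "smooth_field \<psi>" "x \<noteq> 0" for \<psi> x
  proof -
    have "Y33 (Y34 \<psi>) x = \<beta> *s Y33 (\<lambda>y. q *v Y33 \<psi> y) x"
      unfolding Y34 using that by (intro Y smooth_field_matrix)
    then show ?thesis
      using that by (simp add: anti Y(2) vec_eq_iff)
  qed

  \<comment> \<open>Commutators and squares\<close>
  have c1: "commutator K Y33 \<doteq> const_op (2 * \<i> / complex_of_real d10) \<odot> Y34"
  proof (rule op_eqI)
    fix \<psi> :: spinor_field and x :: "real^3"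
    assume "smooth_field \<psi>" "x \<noteq> 0"
    then have "commutator K Y33 \<psi> x = 2 *s (q *v Y33 \<psi> x)"
      by (simp add: commutator_apply YK K[of "Y33 \<psi>"] vec_eq_iff)
    then show "commutator K Y33 \<psi> x = (const_op (2 * \<i> / complex_of_real d10) \<odot> Y34) \<psi> x"
      by (simp add: mult_op_def Y34 vector_smult_assoc \<beta>(1)[simplified])
  qed
  have c2: "commutator K Y34 \<doteq> const_op (- 8 * \<i> * complex_of_real d10) \<odot> Y33"
  proof (rule op_eqI)
    fix \<psi> :: spinor_field and x :: "real^3"
    assume \<psi>: "smooth_field \<psi>" "x \<noteq> 0"
    \<comment> \<open>Moving q past Y33 and using that q squared is 4 gives -4 here and +4 in the
      other order. The q terms cancel in the commutator, leaving 8 \<beta> = -8 i d10.\<close>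
    have "Y34 (K \<psi>) x = \<beta> *s (- 4 *s Y33 \<psi> x - q *v Y33 \<psi> x)"
      unfolding Y34 YK[OF \<psi>] by (simp add: matrix_vector_mult_diff_distrib matrix_vector_mult_uminus qq vec_eq_iff)
    moreover have "K (Y34 \<psi>) x = \<beta> *s (4 *s Y33 \<psi> x - q *v Y33 \<psi> x)"
      unfolding K Y34 by (simp add: vector_scalar_commute qq vec_eq_iff algebra_simps)
    ultimately show "commutator K Y34 \<psi> x = (const_op (- 8 * \<i> * complex_of_real d10) \<odot> Y33) \<psi> x"
      by (simp add: commutator_apply mult_op_def vec_eq_iff \<beta>_def algebra_simps)
  qed
  \<comment> \<open>Both orders contribute -\<beta> q times the square of Y33, and -2 \<beta> is 2 i
    d10.\<close>
  have c3': "commutator Y33 Y34 \<psi> x = (2 * \<i> * complex_of_real d10) *s (q *v (H \<psi> x - complex_of_real d12 *s \<psi> x))"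
    if \<psi>: "smooth_field \<psi>" "x \<noteq> 0" for \<psi> x
    by (simp add: commutator_apply YY34[OF \<psi>] Y34[THEN fun_cong, of "Y33 \<psi>"] square[OF \<psi>] \<beta>_def vec_eq_iff)
  then have c3: "commutator Y33 Y34 \<doteq>
      const_op (2 * \<i> * complex_of_real d10) \<odot> (K + id) \<odot> (H - const_op (complex_of_real d12))"
    by (intro op_eqI) (simp add: mult_op_def K)
  have s1: "Y33 \<odot> Y33 \<doteq> H - const_op (complex_of_real d12)"
    by (rule op_eqI) (simp add: square mult_op_def)
  have s2: "Y34 \<odot> Y34 \<doteq> const_op (4 * (complex_of_real d10)\<^sup>2) \<odot> (H - const_op (complex_of_real d12))"
  proof (rule op_eqI)
    fix \<psi> :: spinor_field and x :: "real^3"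
    assume \<psi>: "smooth_field \<psi>" "x \<noteq> 0"
    \<comment> \<open>One sign comes from moving Y33 past q, and q squared is 4.\<close>
    have "Y34 (Y34 \<psi>) x = (\<beta> * \<beta>) *s (- 4 *s Y33 (Y33 \<psi>) x)"
      unfolding Y34[THEN fun_cong, of "Y34 \<psi>"] YY34[OF \<psi>]
      by (simp add: matrix_vector_mult_uminus vector_scalar_commute qq vec_eq_iff)
    then show "(Y34 \<odot> Y34) \<psi> x
        = (const_op (4 * (complex_of_real d10)\<^sup>2) \<odot> (H - const_op (complex_of_real d12))) \<psi> x"
      unfolding \<beta>(2) square[OF \<psi>] by (simp add: mult_op_def vec_eq_iff)
  qed

  \<comment> \<open>Commutators as ordered polynomials\<close>
  let ?Gs = "[K, Y33, Y34, H]"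
  have mono: "op_monomial ?Gs [a, b, c, d] \<in> op_polynomials ?Gs" for a b c d
    by (rule op_polynomials.monomial) simp
  have p1: "const_op c \<odot> Y34 \<in> op_polynomials ?Gs" for c
    using op_polynomials.scale[OF mono[of 0 0 1 0], of c] by simp
  have p2: "const_op c \<odot> Y33 \<in> op_polynomials ?Gs" for c
    using op_polynomials.scale[OF mono[of 0 1 0 0], of c] by simp
  \<comment> \<open>The product (K + 1)(H - d12), expanded into the ordered monomials K H, H, K and
    1 that \<open>op_polynomials\<close> admits.\<close>
  define P where "P = const_op (2 * \<i> * complex_of_real d10) \<odot>
    ((K \<odot> H + H) + const_op (- complex_of_real d12) \<odot> (K + id))"
  have p3: "P \<in> op_polynomials ?Gs"
  proof -
    have "K \<odot> H \<in> op_polynomials ?Gs" "H \<in> op_polynomials ?Gs" "K \<in> op_polynomials ?Gs"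
      "id \<in> op_polynomials ?Gs"
      using mono[of 1 0 0 1] mono[of 0 0 0 1] mono[of 1 0 0 0] mono[of 0 0 0 0] by simp_all
    then show ?thesis unfolding P_def by (intro op_polynomials.scale op_polynomials.add)
  qed
  have c3P: "commutator Y33 Y34 \<doteq> P"
    by (rule op_eqI) (simp add: c3' P_def K mult_op_def matrix_vector_mult_diff_distrib
        vector_scalar_commute vec_eq_iff algebra_simps)
  have closed: "\<exists>P\<in>op_polynomials ?Gs. commutator A B \<doteq> P"
    if "A \<in> {K, Y33, Y34}" "B \<in> {K, Y33, Y34}" for A B
    using that commutator_self_polynomial[of ?Gs] c1 c2 c3P p1 p2 p3
      commutator_swap_polynomial[OF p1 c1] commutator_swap_polynomial[OF p2 c2]
      commutator_swap_polynomial[OF p3 c3P] by auto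

  \<comment> \<open>Integrals of motion\<close>
  have H: "H \<psi> x = Y33 (Y33 \<psi>) x + complex_of_real d12 *s \<psi> x"
    if "smooth_field \<psi>" "x \<noteq> 0" for \<psi> x
    using square[OF that] by simp
  have motion: "integral_of_motion H A"
    if "smooth_operator A" "\<And>\<psi> x. smooth_field \<psi> \<Longrightarrow> x \<noteq> 0 \<Longrightarrow> A (Y33 (Y33 \<psi>)) x = Y33 (Y33 (A \<psi>)) x" for A
    by (rule integral_of_motion_if_commutes_with_square[OF that(1) smooth_Y33 H smooth_H that(2)])
  \<comment> \<open>Each factor Y33 contributes a sign when q moves past it, and the two signs
    cancel. The sign is written as scaling by -1, so that homogeneity of Y33 applies.\<close>
  have YY_q: "Y33 (Y33 (\<lambda>y. q *v \<psi> y)) x = q *v Y33 (Y33 \<psi>) x"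
    if "smooth_field \<psi>" "x \<noteq> 0" for \<psi> x
  proof -
    have "Y33 (\<lambda>y. q *v \<psi> y) y = (- 1) *s (q *v Y33 \<psi> y)" if "y \<noteq> 0" for y
      unfolding anti[OF \<open>smooth_field \<psi>\<close> that] by (simp add: vec_eq_iff)
    with that have "Y33 (Y33 (\<lambda>y. q *v \<psi> y)) x = Y33 (\<lambda>y. (- 1) *s (q *v Y33 \<psi> y)) x"
      by (intro Y(1) Y(2) smooth_field_matrix smooth_field_scale)
    also have "\<dots> = (- 1) *s - (q *v Y33 (Y33 \<psi>) x)"
      using that by (simp only: Y(2,4) smooth_field_matrix anti not_False_eq_True)
    finally show ?thesis by (simp add: vec_eq_iff)
  qed
  have "integral_of_motion H K"
  proof (rule motion[OF smooth_K])
    fix \<psi> :: spinor_field and x :: "real^3"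
    assume \<psi>: "smooth_field \<psi>" "x \<noteq> 0"
    \<comment> \<open>Writing K as q plus the scalar -1 reduces the claim to \<open>YY_q\<close> and
      linearity.\<close>
    have K': "K \<psi> = (\<lambda>y. q *v \<psi> y + (- 1) *s \<psi> y)"
      by (simp add: fun_eq_iff K vec_eq_iff)
    have "Y33 (Y33 (K \<psi>)) x = Y33 (\<lambda>y. Y33 (\<lambda>y. q *v \<psi> y) y + (- 1) *s Y33 \<psi> y) x"
      unfolding K' using \<psi>
      by (intro Y(1)) (simp_all only: Y(2,3,4) smooth_field_add smooth_field_matrix smooth_field_scale not_False_eq_True)
    also have "\<dots> = q *v Y33 (Y33 \<psi>) x + (- 1) *s Y33 (Y33 \<psi>) x"
      using \<psi> by (simp only: Y(2,3,4) smooth_field_matrix smooth_field_scale YY_q not_False_eq_True)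
    finally show "K (Y33 (Y33 \<psi>)) x = Y33 (Y33 (K \<psi>)) x"
      by (simp add: K vec_eq_iff)
  qed
  moreover have "integral_of_motion H Y33"
    by (rule motion[OF smooth_Y33]) simp
  moreover have "integral_of_motion H Y34"
  proof (rule motion[OF smooth_Y34])
    fix \<psi> :: spinor_field and x :: "real^3"
    assume \<psi>: "smooth_field \<psi>" "x \<noteq> 0"
    have "Y33 (Y33 (Y34 \<psi>)) x = Y33 (\<lambda>y. \<beta> *s Y33 (\<lambda>y. q *v Y33 \<psi> y) y) x"
      unfolding Y34 using \<psi> by (intro Y(1)) (simp_all only: Y(2,4) smooth_field_matrix smooth_field_scale not_False_eq_True)
    \<comment> \<open>\<open>YY_q\<close> is applied to the field Y33 \<psi>, after \<beta> has been
      taken out by homogeneity.\<close>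
    also have "\<dots> = \<beta> *s (q *v Y33 (Y33 (Y33 \<psi>)) x)"
      using \<psi> by (simp only: Y(2,4) smooth_field_matrix YY_q not_False_eq_True)
    finally show "Y34 (Y33 (Y33 \<psi>)) x = Y33 (Y33 (Y34 \<psi>)) x"
      by (simp add: Y34)
  qed
  ultimately have "generate_finite_polynomial_symmetry_algebra H [K, Y33, Y34]"
    unfolding generate_finite_polynomial_symmetry_algebra_def using smooth_H closed by simp
  with c1 c2 c3 s1 s2 show ?thesis by blast
qed

end
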